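(* There is no FPRAS to estimate the $s-t$ unreliability in directed acyclic graphs unless there is an FPRAS for $\#\mathbf{BIS}$. This remains true even when restricted to instances in which all edges fail with the same probability.
   Context: For a directed graph $G=(V,E)$ with failure probabilities $q_e\in[0,1]$ and vertices $s,t$, let $\mathcal{G}$ be the random spanning subgraph in which each edge $e$ is kept independently with probability $1-q_e$ (and removed with probability $q_e$). The $s-t$ unreliability is the probability that there is no directed path from $s$ to $t$ in $\mathcal{G}$. An FPRAS (fully polynomial-time randomized approximation scheme) is a randomized algorithm which, given an instance and $\varepsilon>0$, outputs a $(1\pm\varepsilon)$ multiplicative approximation of the quantity with probability at least $3/4$, in time polynomial in the instance size and $1/\varepsilon$. $\#\mathbf{BIS}$ is the problem of counting the independent sets of a bipartite graph. *)

theory Defs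
  imports "HOL-Probability.Probability"
begin

section \<open>Randomized algorithms\<close>

text \<open>
  The machine model is the WHILE language over binary trees of N. D. Jones (\<^emph>\<open>Computability and
  Complexity from a Programming Perspective\<close>), extended by a fair coin. As in pure LISP, values are
  pointers to immutable cells, so each instruction has unit cost, and a condition only inspects
  whether a value is the atom. Polynomial time in this model coincides with polynomial time on
  Turing machines.
\<close>

datatype sexp = Atom | Cell sexp sexp

fun car :: "sexp \<Rightarrow> sexp" where
  "car Atom = Atom"
| "car (Cell x y) = x"

fun cdr :: "sexp \<Rightarrow> sexp" where
  "cdr Atom = Atom"
| "cdr (Cell x y) = y"

datatype expr = Var nat | Nl | Cons expr expr | Car expr | Cdr expr

type_synonym store = "nat \<Rightarrow> sexp"

primrec eval_expr :: "store \<Rightarrow> expr \<Rightarrow> sexp" where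
  "eval_expr \<sigma> (Var x) = \<sigma> x"
| "eval_expr \<sigma> Nl = Atom"
| "eval_expr \<sigma> (Cons e1 e2) = Cell (eval_expr \<sigma> e1) (eval_expr \<sigma> e2)"
| "eval_expr \<sigma> (Car e) = car (eval_expr \<sigma> e)"
| "eval_expr \<sigma> (Cdr e) = cdr (eval_expr \<sigma> e)"

datatype com =
    Assign nat expr
  | Flip nat
  | Seq com com
  | If expr com com
  | While expr com

definition enc_bool :: "bool \<Rightarrow> sexp" where
  "enc_bool b = (if b then Cell Atom Atom else Atom)"

text \<open>A configuration is the stack of commands still to be executed together with the store; the
  machine has halted when the stack is empty.\<close>

type_synonym config = "com list \<times> store"

fun step :: "config \<Rightarrow> config pmf" where
  "step ([], \<sigma>) = return_pmf ([], \<sigma>)"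
| "step (Assign x e # cs, \<sigma>) = return_pmf (cs, \<sigma>(x := eval_expr \<sigma> e))"
| "step (Flip x # cs, \<sigma>) = map_pmf (\<lambda>b. (cs, \<sigma>(x := enc_bool b))) (bernoulli_pmf (1/2))"
| "step (Seq c1 c2 # cs, \<sigma>) = return_pmf (c1 # c2 # cs, \<sigma>)"
| "step (If e c1 c2 # cs, \<sigma>) =
     return_pmf (if eval_expr \<sigma> e \<noteq> Atom then (c1 # cs, \<sigma>) else (c2 # cs, \<sigma>))"
| "step (While e c # cs, \<sigma>) =
     return_pmf (if eval_expr \<sigma> e \<noteq> Atom then (c # While e c # cs, \<sigma>) else (cs, \<sigma>))"

primrec run :: "nat \<Rightarrow> config \<Rightarrow> config pmf" where
  "run 0 cfg = return_pmf cfg"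
| "run (Suc n) cfg = bind_pmf (step cfg) (run n)"

text \<open>Variable 0 holds the input initially and the output on termination.\<close>

definition start :: "com \<Rightarrow> sexp \<Rightarrow> config" where
  "start P v = ([P], (\<lambda>_. Atom)(0 := v))"

definition halts_within :: "com \<Rightarrow> sexp \<Rightarrow> nat \<Rightarrow> bool" where
  "halts_within P v T \<longleftrightarrow> (\<forall>(cs, \<sigma>) \<in> set_pmf (run T (start P v)). cs = [])"

definition output_pmf :: "com \<Rightarrow> sexp \<Rightarrow> nat \<Rightarrow> sexp pmf" where
  "output_pmf P v T = map_pmf (\<lambda>(cs, \<sigma>). \<sigma> 0) (run T (start P v))"


section \<open>Encodings\<close>

text \<open>Naturals are written in binary, least significant bit first.\<close>

fun enc_nat :: "nat \<Rightarrow> sexp" where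
  "enc_nat n = (if n = 0 then Atom else Cell (enc_bool (odd n)) (enc_nat (n div 2)))"

declare enc_nat.simps [simp del]

fun enc_list :: "('a \<Rightarrow> sexp) \<Rightarrow> 'a list \<Rightarrow> sexp" where
  "enc_list f [] = Atom"
| "enc_list f (x # xs) = Cell (f x) (enc_list f xs)"

fun enc_pair :: "('a \<Rightarrow> sexp) \<Rightarrow> ('b \<Rightarrow> sexp) \<Rightarrow> 'a \<times> 'b \<Rightarrow> sexp" where
  "enc_pair f g (x, y) = Cell (f x) (g y)"

text \<open>Nonnegative rationals are given as numerator and denominator, not necessarily in lowest
  terms.\<close>

type_synonym fraction = "nat \<times> nat"

definition valid_fraction :: "fraction \<Rightarrow> bool" where
  "valid_fraction r \<longleftrightarrow> snd r > 0"

definition frac_val :: "fraction \<Rightarrow> real" where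
  "frac_val r = real (fst r) / real (snd r)"

definition enc_fraction :: "fraction \<Rightarrow> sexp" where
  "enc_fraction = enc_pair enc_nat enc_nat"


section \<open>Fully polynomial-time randomized approximation schemes\<close>

definition approximates :: "real \<Rightarrow> real \<Rightarrow> sexp \<Rightarrow> bool" where
  "approximates \<epsilon> a out \<longleftrightarrow>
     (\<exists>r. valid_fraction r \<and> out = enc_fraction r \<and>
          (1 - \<epsilon>) * a \<le> frac_val r \<and> frac_val r \<le> (1 + \<epsilon>) * a)"

text \<open>A counting problem is given by the encoding of instances, the set of legal instances and the
  quantity to be estimated. The behaviour on illegal inputs is unconstrained.
  The generated \<^const>\<open>size\<close> of a tree is its number of cells.\<close>

definition is_FPRAS :: "('i \<Rightarrow> sexp) \<Rightarrow> 'i set \<Rightarrow> ('i \<Rightarrow> real) \<Rightarrow> com \<Rightarrow> bool" where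
  "is_FPRAS enc I f P \<longleftrightarrow>
     (\<exists>C k :: nat. \<forall>x\<in>I. \<forall>\<epsilon>. valid_fraction \<epsilon> \<and> frac_val \<epsilon> > 0 \<longrightarrow>
        (let v = Cell (enc x) (enc_fraction \<epsilon>) in
         \<exists>T. real T \<le> real C * (real (size v) + 1 / frac_val \<epsilon>) ^ k \<and>
             halts_within P v T \<and>
             measure_pmf.prob (output_pmf P v T) {out. approximates (frac_val \<epsilon>) (f x) out} \<ge> 3/4))"

definition has_FPRAS :: "('i \<Rightarrow> sexp) \<Rightarrow> 'i set \<Rightarrow> ('i \<Rightarrow> real) \<Rightarrow> bool" where
  "has_FPRAS enc I f \<longleftrightarrow> (\<exists>P. is_FPRAS enc I f P)"


section \<open>Two-terminal unreliability\<close>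

definition random_subgraph :: "('v \<times> 'v) set \<Rightarrow> ('v \<times> 'v \<Rightarrow> real) \<Rightarrow> ('v \<times> 'v) set pmf" where
  "random_subgraph E q =
     map_pmf (\<lambda>kept. {e \<in> E. kept e}) (Pi_pmf E False (\<lambda>e. bernoulli_pmf (1 - q e)))"

definition st_unreliability :: "('v \<times> 'v) set \<Rightarrow> ('v \<times> 'v \<Rightarrow> real) \<Rightarrow> 'v \<Rightarrow> 'v \<Rightarrow> real" where
  "st_unreliability E q s t = measure_pmf.prob (random_subgraph E q) {F. (s, t) \<notin> F\<^sup>*}"

record st_instance =
  st_verts :: "nat list"
  st_arcs :: "((nat \<times> nat) \<times> fraction) list"
  st_source :: nat
  st_sink :: nat

definition arc_set :: "st_instance \<Rightarrow> (nat \<times> nat) set" where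
  "arc_set G = fst ` set (st_arcs G)"

definition fail_prob :: "st_instance \<Rightarrow> nat \<times> nat \<Rightarrow> real" where
  "fail_prob G e = (case map_of (st_arcs G) e of Some r \<Rightarrow> frac_val r | None \<Rightarrow> 0)"

definition valid_st_instance :: "st_instance \<Rightarrow> bool" where
  "valid_st_instance G \<longleftrightarrow>
     distinct (st_verts G) \<and>
     distinct (map fst (st_arcs G)) \<and>
     arc_set G \<subseteq> set (st_verts G) \<times> set (st_verts G) \<and>
     st_source G \<in> set (st_verts G) \<and> st_sink G \<in> set (st_verts G) \<and>
     (\<forall>(e, r) \<in> set (st_arcs G). valid_fraction r \<and> frac_val r \<in> {0..1})"

definition dag_instances :: "st_instance set" where
  "dag_instances = {G. valid_st_instance G \<and> acyclic (arc_set G)}"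

definition uniform_dag_instances :: "st_instance set" where
  "uniform_dag_instances = {G \<in> dag_instances. \<exists>q. \<forall>e \<in> arc_set G. fail_prob G e = q}"

definition unreliability :: "st_instance \<Rightarrow> real" where
  "unreliability G = st_unreliability (arc_set G) (fail_prob G) (st_source G) (st_sink G)"

definition enc_st_instance :: "st_instance \<Rightarrow> sexp" where
  "enc_st_instance G =
     Cell (enc_list enc_nat (st_verts G))
       (Cell (enc_list (enc_pair (enc_pair enc_nat enc_nat) enc_fraction) (st_arcs G))
         (Cell (enc_nat (st_source G)) (enc_nat (st_sink G))))"


section \<open>Independent sets of bipartite graphs\<close>

record bipartite_instance =
  bip_left :: "nat list"
  bip_right :: "nat list"
  bip_edges :: "(nat \<times> nat) list"

definition bipartite_instances :: "bipartite_instance set" where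
  "bipartite_instances =
     {B. distinct (bip_left B) \<and> distinct (bip_right B) \<and> distinct (bip_edges B) \<and>
         set (bip_left B) \<inter> set (bip_right B) = {} \<and>
         set (bip_edges B) \<subseteq> set (bip_left B) \<times> set (bip_right B)}"

definition independent_sets :: "'v set \<Rightarrow> ('v \<times> 'v) set \<Rightarrow> 'v set set" where
  "independent_sets V E = {S. S \<subseteq> V \<and> (\<forall>(u, v) \<in> E. \<not> (u \<in> S \<and> v \<in> S))}"

definition num_BIS :: "bipartite_instance \<Rightarrow> real" where
  "num_BIS B =
     real (card (independent_sets (set (bip_left B) \<union> set (bip_right B)) (set (bip_edges B))))"

definition enc_bipartite_instance :: "bipartite_instance \<Rightarrow> sexp" where
  "enc_bipartite_instance B =
     Cell (enc_list enc_nat (bip_left B))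
       (Cell (enc_list enc_nat (bip_right B))
         (enc_list (enc_pair enc_nat enc_nat) (bip_edges B)))"

end

theory Submission
  imports Defs
begin

text \<open>
  Give every arc failure probability \<open>1/2\<close>. Join the source to every left vertex and every right vertex
  to the sink, and replace each edge of the bipartite graph by \<open>k\<close> parallel paths of length two. The
  left vertices whose arc from the source survives and the right vertices whose arc to the sink
  survives form a uniformly random set \<open>S\<close> of vertices. If \<open>S\<close> is independent then source and sink are
  separated; otherwise some edge lies inside \<open>S\<close>, and all its \<open>k\<close> paths fail with probability
  \<open>(3/4) ^ k\<close>. Hence \<open>2 ^ n\<close> times the unreliability exceeds the number of independent sets by at most
  \<open>2 ^ n * (3/4) ^ k\<close>, which is negligible for a \<open>k\<close> linear in \<open>n\<close> and in the number of digits of the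
  denominator of the error bound. The reduction runs the given scheme with half the error bound and
  multiplies its output by \<open>2 ^ n\<close>.
\<close>

section \<open>Networks with bundles of parallel paths\<close>

text \<open>Arcs form a set and must share one failure probability, so an edge cannot be reinforced
  by parallel arcs; each copy becomes a path through its own inner vertex. Such a path survives with
  probability 1/4, whence the base 3/4. The counting error is additive, but the empty set is always
  independent, so it is also a relative error. An error bound \<open>p / d\<close> with positive
  \<open>p\<close> is at least \<open>1 / d\<close>; this is why the number of paths depends on the
  digits of \<open>d\<close>, and stays small even when \<open>d\<close> is exponential in the input
  length. The machine model is the other obstacle. The given scheme is an arbitrary randomized
  program: it is promised to work only from a store that is empty except for the input, it may halt
  after different times on different coin outcomes, and with probability up to 1/4 it may output any
  tree. Hence the reduction keeps its own data in variables that the scheme never mentions, all code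
  around the scheme is deterministic, and the final scaling makes sense on every tree.\<close>

locale bundle_network =
  fixes L R :: "'a set" and J :: "'j set" and edge :: "'j \<Rightarrow> 'a \<times> 'a"
    and s t :: 'v and old :: "'a \<Rightarrow> 'v" and mid :: "'j \<Rightarrow> 'v"
  assumes finite_L: "finite L" and finite_R: "finite R" and finite_J: "finite J"
    and disjoint: "L \<inter> R = {}"
    and edge: "j \<in> J \<Longrightarrow> edge j \<in> L \<times> R"
    and inj_old: "inj old" and inj_mid: "inj mid"
    and names [simp]: "s \<noteq> t" "s \<noteq> old x" "t \<noteq> old x" "s \<noteq> mid j" "t \<noteq> mid j" "old x \<noteq> mid j"
begin

lemma names' [simp]: "t \<noteq> s" "old x \<noteq> s" "old x \<noteq> t" "mid j \<noteq> s" "mid j \<noteq> t" "mid j \<noteq> old x"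
  using names by metis+

lemma old_eq [simp]: "old x = old y \<longleftrightarrow> x = y"
  using inj_old by (auto dest: injD)

lemma mid_eq [simp]: "mid i = mid j \<longleftrightarrow> i = j"
  using inj_mid by (auto dest: injD)

text \<open>The encoding of a random vertex set: a vertex belongs to \<open>S\<close> when its
  unique arc to \<open>s\<close> or \<open>t\<close> survives.\<close>

definition side :: "'a set \<Rightarrow> ('v \<times> 'v) set" where
  "side S = (\<lambda>x. (s, old x)) ` (S \<inter> L) \<union> (\<lambda>y. (old y, t)) ` (S \<inter> R)"

text \<open>\<open>J\<close> indexes paths, not edges: the copies of an edge are distinct indices on
  which \<open>edge\<close> takes the same value, each with its private inner vertex
  \<open>mid j\<close>.\<close>

definition link :: "'j \<Rightarrow> ('v \<times> 'v) set" where
  "link j = {(old (fst (edge j)), mid j), (mid j, old (snd (edge j)))}"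

definition arcs :: "('v \<times> 'v) set" where
  "arcs = side (L \<union> R) \<union> \<Union> (link ` J)"

definition cuts :: "('v \<times> 'v) set set" where
  "cuts = {F \<in> Pow arcs. (s, t) \<notin> F\<^sup>*}"

abbreviation indep :: "'a set set" where
  "indep \<equiv> independent_sets (L \<union> R) (edge ` J)"

section \<open>Cardinalities of the arc sets and recovery of the vertex set\<close>

lemma finite_side: "finite (side S)"
  unfolding side_def using finite_L finite_R by auto

lemma finite_links: "finite (\<Union> (link ` J))"
  using finite_J by (auto simp: link_def)

lemma finite_arcs: "finite arcs"
  unfolding arcs_def using finite_side finite_links by auto

lemma card_link: "card (link j) = 2"
  by (simp add: link_def)

lemma link_disjoint: "i \<noteq> j \<Longrightarrow> link i \<inter> link j = {}"
  by (auto simp: link_def)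

lemma side_link_disjoint: "side S \<inter> link j = {}"
  by (auto simp: link_def side_def)

lemma card_links: "card (\<Union> (link ` J)) = 2 * card J"
proof -
  have "card (\<Union> (link ` J)) = (\<Sum>j\<in>J. card (link j))"
    by (rule card_UN_disjoint) (use finite_J link_disjoint in \<open>auto simp: link_def\<close>)
  then show ?thesis by (simp add: card_link)
qed

lemma side_inj: "inj_on side (Pow (L \<union> R))"
proof (rule inj_onI)
  fix S S' assume *: "S \<in> Pow (L \<union> R)" "S' \<in> Pow (L \<union> R)" "side S = side S'"
  have "S = {x \<in> L. (s, old x) \<in> side S} \<union> {y \<in> R. (old y, t) \<in> side S}" if "S \<in> Pow (L \<union> R)" for S
    using that disjoint by (auto simp: side_def)
  from this[OF *(1)] this[OF *(2)] show "S = S'" unfolding *(3) by (rule trans[OF _ sym])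
qed

lemma card_side: "card (side (L \<union> R)) = card (L \<union> R)"
proof -
  have *: "(L \<union> R) \<inter> L = L" "(L \<union> R) \<inter> R = R" by auto
  have "card (side (L \<union> R)) = card ((\<lambda>x. (s, old x)) ` L) + card ((\<lambda>y. (old y, t)) ` R)"
    unfolding side_def * by (rule card_Un_disjoint) (use finite_L finite_R in auto)
  also have "\<dots> = card L + card R"
    by (simp add: card_image inj_on_def)
  finally show ?thesis
    using finite_L finite_R disjoint by (simp add: card_Un_disjoint)
qed

lemma card_arcs: "card arcs = card (L \<union> R) + 2 * card J"
proof -
  have "card arcs = card (side (L \<union> R)) + card (\<Union> (link ` J))"
    unfolding arcs_def
    by (rule card_Un_disjoint) (use finite_side finite_links side_link_disjoint in auto)
  then show ?thesis by (simp add: card_side card_links)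
qed

lemma side_of_subset:
  assumes "F \<subseteq> side (L \<union> R)"
  obtains S where "S \<subseteq> L \<union> R" "F = side S"
proof
  let ?S = "{x \<in> L. (s, old x) \<in> F} \<union> {y \<in> R. (old y, t) \<in> F}"
  show "?S \<subseteq> L \<union> R" by auto
  show "F = side ?S" using assms disjoint by (auto simp: side_def)
qed

text \<open>Right vertices entered from \<open>S\<close> lie outside \<open>S\<close> by
  independence, so their arcs to \<open>t\<close> are missing; links never lead back to the left
  side.\<close>

lemma independent_imp_cut:
  assumes S: "S \<in> indep" and F: "F \<subseteq> side S \<union> \<Union> (link ` J)"
  shows "(s, t) \<notin> F\<^sup>*"
proof
  \<comment> \<open>An upper estimate of what \<open>s\<close> reaches even if every link survives:
    it contains \<open>s\<close>, is closed under the arcs of \<open>F\<close> and misses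
    \<open>t\<close>.\<close>
  let ?Z = "{s} \<union> old ` (S \<inter> L) \<union> mid ` {j \<in> J. fst (edge j) \<in> S}
              \<union> old ` (snd ` edge ` {j \<in> J. fst (edge j) \<in> S})"
  have out: "snd (edge j) \<notin> S" if "j \<in> J" "fst (edge j) \<in> S" for j
    using S that unfolding independent_sets_def by (auto simp: split_beta)
  have R: "snd (edge j) \<in> R" "snd (edge j) \<notin> L" "fst (edge j) \<in> L" "fst (edge j) \<notin> R" if "j \<in> J" for j
    using edge[OF that] disjoint by (auto simp: mem_Times_iff)
  assume "(s, t) \<in> F\<^sup>*"
  moreover have "v \<in> ?Z" if "(u, v) \<in> F" "u \<in> ?Z" for u v
  proof -
    from that F have "(u, v) \<in> side S \<or> (\<exists>j\<in>J. (u, v) \<in> link j)" by auto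
    then show ?thesis
    proof
      assume "(u, v) \<in> side S"
      then show ?thesis using that(2) disjoint out by (auto simp: side_def)
    next
      assume "\<exists>j\<in>J. (u, v) \<in> link j"
      then obtain j where "j \<in> J" "(u, v) \<in> link j" by auto
      then consider "u = old (fst (edge j))" "v = mid j" | "u = mid j" "v = old (snd (edge j))"
        by (auto simp: link_def)
      then show ?thesis
      proof cases
        case 1
        \<comment> \<open>The last part of \<open>?Z\<close> consists of right vertices, so a left
          vertex can be in \<open>?Z\<close> only through \<open>S\<close>.\<close>
        have "old (fst (edge j)) \<notin> old ` (snd ` edge ` {j \<in> J. fst (edge j) \<in> S})"
          using R(1) R(4)[OF \<open>j \<in> J\<close>] by auto
        with 1 that(2) have "fst (edge j) \<in> S" by auto
        with 1 \<open>j \<in> J\<close> show ?thesis by blast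
      next
        case 2
        with that(2) have "fst (edge j) \<in> S" by auto
        with 2 \<open>j \<in> J\<close> show ?thesis by blast
      qed
    qed
  qed
  ultimately have "t \<in> ?Z"
    by (induction rule: rtrancl_induct) auto
  then show False by auto
qed

text \<open>Otherwise the two outer arcs and the link would join into a path of four arcs from
  \<open>s\<close> to \<open>t\<close>.\<close>

lemma cut_breaks_links:
  assumes "(s, t) \<notin> F\<^sup>*" "side S \<subseteq> F" "j \<in> J" "fst (edge j) \<in> S" "snd (edge j) \<in> S"
  shows "\<not> link j \<subseteq> F"
proof
  assume "link j \<subseteq> F"
  moreover have "(s, old (fst (edge j))) \<in> F" "(old (snd (edge j)), t) \<in> F"
    using assms edge[of j] by (auto simp: side_def mem_Times_iff)
  ultimately have "(s, t) \<in> F\<^sup>*"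
    unfolding link_def by (meson insert_subset r_into_rtrancl rtrancl.rtrancl_into_rtrancl)
  with assms show False by simp
qed

text \<open>The choices multiply over the paths: a two-element link has 4 subsets, and 3 if the full
  one is forbidden. Covering the family by the image of a product suffices for an upper
  bound.\<close>

lemma card_broken_links_le:
  assumes "finite I"
  shows "card {M. M \<subseteq> \<Union> (link ` I) \<and> (\<forall>j\<in>I \<inter> B. \<not> link j \<subseteq> M)}
           \<le> (\<Prod>j\<in>I. if j \<in> B then 3 else 4)"
  using assms
proof (induction I)
  case empty
  then show ?case by simp
next
  case (insert i I)
  let ?X = "\<lambda>I. {M. M \<subseteq> \<Union> (link ` I) \<and> (\<forall>j\<in>I \<inter> B. \<not> link j \<subseteq> M)}"
  let ?Y = "if i \<in> B then Pow (link i) - {link i} else Pow (link i)"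
  have fin: "finite (?X I)"
    by (rule finite_subset[of _ "Pow (\<Union> (link ` I))"]) (use insert in \<open>auto simp: link_def\<close>)
  have finY: "finite ?Y" by (auto simp: link_def)
  have cardY: "card ?Y = (if i \<in> B then 3 else 4)"
    by (auto simp: card_Diff_singleton card_Pow link_def card_insert_if)
  have "?X (insert i I) \<subseteq> (\<lambda>(M, M'). M \<union> M') ` (?Y \<times> ?X I)"
  proof
    fix M assume M: "M \<in> ?X (insert i I)"
    have "M \<inter> link i \<in> ?Y" using M by auto
    moreover have "M \<inter> \<Union> (link ` I) \<in> ?X I" using M by auto
    moreover have "M = (M \<inter> link i) \<union> (M \<inter> \<Union> (link ` I))" using M by auto
    ultimately show "M \<in> (\<lambda>(M, M'). M \<union> M') ` (?Y \<times> ?X I)"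
      by (intro image_eqI[where x = "(M \<inter> link i, M \<inter> \<Union> (link ` I))"]) simp_all
  qed
  then have "card (?X (insert i I)) \<le> card (?Y \<times> ?X I)"
    using fin finY by (intro surj_card_le) auto
  also have "\<dots> = card ?Y * card (?X I)" by (rule card_cartesian_product)
  also have "\<dots> \<le> card ?Y * (\<Prod>j\<in>I. if j \<in> B then 3 else 4)"
    using insert by (intro mult_left_mono) auto
  also have "\<dots> = (\<Prod>j\<in>insert i I. if j \<in> B then 3 else 4)"
    using insert by (simp add: cardY)
  finally show ?case .
qed

section \<open>Counting cuts against independent sets\<close>

lemma finite_indep: "finite indep"
  by (rule finite_subset[of _ "Pow (L \<union> R)"]) (use finite_L finite_R in \<open>auto simp: independent_sets_def\<close>)

text \<open>An independent set may be combined with any set of link arcs, and both can be read off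
  from the resulting cut; there are \<open>2 * card J\<close> link arcs.\<close>

lemma card_cuts_ge: "card indep * 4 ^ card J \<le> card cuts"
proof -
  have "inj_on (\<lambda>(S, M). side S \<union> M) (indep \<times> Pow (\<Union> (link ` J)))"
  proof (rule inj_onI, clarify)
    fix S M S' M'
    assume *: "S \<in> indep" "S' \<in> indep" "M \<subseteq> \<Union> (link ` J)" "M' \<subseteq> \<Union> (link ` J)"
      "side S \<union> M = side S' \<union> M'"
    have "(side S \<union> M) \<inter> \<Union> (link ` J) = M" "(side S \<union> M) - \<Union> (link ` J) = side S"
      if "M \<subseteq> \<Union> (link ` J)" for S M
      using that side_link_disjoint[of S] by blast+
    with * have "M = M'" "side S = side S'" by metis+
    then show "S = S' \<and> M = M'"
      using * side_inj by (auto simp: inj_on_def independent_sets_def)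
  qed
  then have "card ((\<lambda>(S, M). side S \<union> M) ` (indep \<times> Pow (\<Union> (link ` J)))) = card indep * 4 ^ card J"
    by (simp add: card_image card_cartesian_product card_Pow finite_links card_links power_mult)
  moreover have "(\<lambda>(S, M). side S \<union> M) ` (indep \<times> Pow (\<Union> (link ` J))) \<subseteq> cuts"
  proof clarify
    fix S M assume *: "S \<in> indep" "M \<subseteq> \<Union> (link ` J)"
    then have "side S \<subseteq> side (L \<union> R)" by (auto simp: side_def independent_sets_def)
    moreover have "(s, t) \<notin> (side S \<union> M)\<^sup>*" using * by (intro independent_imp_cut) auto
    ultimately show "side S \<union> M \<in> cuts" using * by (auto simp: cuts_def arcs_def)
  qed
  moreover have "finite cuts" using finite_arcs by (simp add: cuts_def)
  ultimately show ?thesis by (metis card_mono)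
qed

text \<open>Cuts are sorted by the vertex set \<open>S\<close> of their outer arcs. An independent
  \<open>S\<close> admits at most all sets of link arcs; any other \<open>S\<close> contains both
  ends of some edge, and breaking its at least \<open>K\<close> paths leaves at most a fraction
  \<open>(3/4) ^ K\<close> of them.\<close>

lemma card_cuts_le:
  assumes K: "\<And>e. e \<in> edge ` J \<Longrightarrow> K \<le> card {j \<in> J. edge j = e}"
  shows "real (card cuts) \<le> real (card indep) * 4 ^ card J
           + 2 ^ card (L \<union> R) * (4 ^ card J * (3/4) ^ K)"
proof -
  let ?links = "\<Union> (link ` J)"
  let ?X = "\<lambda>S. {M. M \<subseteq> ?links \<and> (\<forall>j\<in>J \<inter> {j. fst (edge j) \<in> S \<and> snd (edge j) \<in> S}. \<not> link j \<subseteq> M)}"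
  let ?N = "Pow (L \<union> R) - indep"
  let ?f = "\<lambda>(S, M). side S \<union> M"
  have finX: "finite (?X S)" for S
    by (rule finite_subset[of _ "Pow ?links"]) (use finite_links in auto)
  have finN: "finite ?N" using finite_L finite_R by auto
  have "cuts \<subseteq> ?f ` (indep \<times> Pow ?links) \<union> ?f ` (Sigma ?N ?X)"
  proof
    fix F assume F: "F \<in> cuts"
    then obtain S where S: "S \<subseteq> L \<union> R" "F \<inter> side (L \<union> R) = side S"
      using side_of_subset[of "F \<inter> side (L \<union> R)"] by blast
    let ?M = "F \<inter> ?links"
    have eq: "F = side S \<union> ?M" using F S(2) by (auto simp: cuts_def arcs_def)
    have "?M \<in> ?X S"
      using F cut_breaks_links[of F S] eq by (auto simp: cuts_def)
    then have "(S, ?M) \<in> indep \<times> Pow ?links \<union> Sigma ?N ?X"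
      using S(1) by (cases "S \<in> indep") auto
    moreover have "F = ?f (S, ?M)" using eq by simp
    ultimately show "F \<in> ?f ` (indep \<times> Pow ?links) \<union> ?f ` (Sigma ?N ?X)" by blast
  qed
  then have "card cuts \<le> card (?f ` (indep \<times> Pow ?links) \<union> ?f ` (Sigma ?N ?X))"
    using finX finN finite_indep finite_links by (intro card_mono) auto
  also have "\<dots> \<le> card (?f ` (indep \<times> Pow ?links)) + card (?f ` (Sigma ?N ?X))"
    by (rule card_Un_le)
  also have "\<dots> \<le> card (indep \<times> Pow ?links) + card (Sigma ?N ?X)"
    using finX finN finite_indep finite_links by (intro add_mono card_image_le) auto
  also have "card (indep \<times> Pow ?links) = card indep * 4 ^ card J"
    by (simp add: card_cartesian_product card_Pow finite_links card_links power_mult)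
  also have "card (Sigma ?N ?X) = (\<Sum>S\<in>?N. card (?X S))"
    using finX finN by (simp add: card_SigmaI)
  finally have "real (card cuts) \<le> real (card indep * 4 ^ card J + (\<Sum>S\<in>?N. card (?X S)))"
    by (simp only: of_nat_le_iff)
  also have "\<dots> = real (card indep) * 4 ^ card J + (\<Sum>S\<in>?N. real (card (?X S)))"
    by simp
  also have "(\<Sum>S\<in>?N. real (card (?X S))) \<le> (\<Sum>S\<in>?N. 4 ^ card J * (3/4) ^ K)"
  proof (rule sum_mono)
    fix S assume S: "S \<in> ?N"
    let ?B = "{j. fst (edge j) \<in> S \<and> snd (edge j) \<in> S}"
    have "S \<subseteq> L \<union> R" "S \<notin> indep" using S by auto
    then have "\<exists>i\<in>J. i \<in> ?B" by (simp add: independent_sets_def split_beta)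
    then obtain i where i: "i \<in> J" "i \<in> ?B" by auto
    have "K \<le> card {j \<in> J. edge j = edge i}" using K i by auto
    also have "\<dots> \<le> card (J \<inter> ?B)"
      using finite_J i by (intro card_mono) auto
    finally have KB: "K \<le> card (J \<inter> ?B)" .
    have "real (card (?X S)) \<le> real (\<Prod>j\<in>J. if j \<in> ?B then 3 else 4)"
      using card_broken_links_le[OF finite_J, of ?B] by (simp only: of_nat_le_iff)
    \<comment> \<open>Writing 3 as \<open>4 * (3/4)\<close> separates the number of all link subsets
      from the density of those with broken paths.\<close>
    also have "\<dots> = (\<Prod>j\<in>J. 4 * (if j \<in> ?B then 3/4 else 1))"
      unfolding of_nat_prod by (rule prod.cong) auto
    also have "\<dots> = 4 ^ card J * (3/4) ^ card (J \<inter> ?B)"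
      unfolding prod.distrib using finite_J by (simp add: prod.If_cases)
    also have "\<dots> \<le> 4 ^ card J * (3/4) ^ K"
      using KB by (intro mult_left_mono power_decreasing) auto
    finally show "real (card (?X S)) \<le> 4 ^ card J * (3/4) ^ K" .
  qed
  also have "\<dots> = real (card ?N) * (4 ^ card J * (3/4) ^ K)" by simp
  also have "\<dots> \<le> 2 ^ card (L \<union> R) * (4 ^ card J * (3/4) ^ K)"
  proof (rule mult_right_mono)
    have "card ?N \<le> card (Pow (L \<union> R))" using finite_L finite_R by (intro card_mono) auto
    also have "\<dots> = 2 ^ card (L \<union> R)"
      using finite_L finite_R by (simp add: card_Pow)
    finally have "real (card ?N) \<le> real (2 ^ card (L \<union> R))" by (simp only: of_nat_le_iff)
    then show "real (card ?N) \<le> 2 ^ card (L \<union> R)" by simp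
  qed simp
  finally show ?thesis by simp
qed

section \<open>From counting cuts to probabilities\<close>

lemma st_unreliability_arcs:
  assumes "\<And>e. e \<in> arcs \<Longrightarrow> q e = 1/2"
  shows "st_unreliability arcs q s t = card cuts / 2 ^ card arcs"
proof -
  have "Pi_pmf arcs False (\<lambda>e. bernoulli_pmf (1 - q e)) = Pi_pmf arcs False (\<lambda>_. bernoulli_pmf (1/2))"
    by (rule Pi_pmf_cong) (simp_all add: assms)
  then have "random_subgraph arcs q = pmf_of_set (Pow arcs)"
    unfolding random_subgraph_def using finite_arcs by (simp add: pmf_of_set_Pow_conv_bernoulli)
  then show ?thesis
    unfolding st_unreliability_def using finite_arcs
    by (simp add: measure_pmf_of_set cuts_def card_Pow Int_def Pow_not_empty)
qed

lemma st_unreliability_bounds: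
  assumes q: "\<And>e. e \<in> arcs \<Longrightarrow> q e = 1/2"
    and K: "\<And>e. e \<in> edge ` J \<Longrightarrow> K \<le> card {j \<in> J. edge j = e}"
  shows "real (card indep) \<le> st_unreliability arcs q s t * 2 ^ card (L \<union> R)"
    and "st_unreliability arcs q s t * 2 ^ card (L \<union> R)
           \<le> real (card indep) + 2 ^ card (L \<union> R) * (3/4) ^ K"
proof -
  \<comment> \<open>The outer arcs contribute exactly the factor
    \<open>2 ^ card (L \<union> R)\<close>, which cancels; the link arcs leave
    \<open>2 ^ (2 * card J)\<close>.\<close>
  have eq: "st_unreliability arcs q s t * 2 ^ card (L \<union> R) = card cuts / 4 ^ card J"
    using st_unreliability_arcs[OF q] by (simp add: card_arcs power_add power_mult)
  have "real (card indep * 4 ^ card J) \<le> real (card cuts)"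
    using card_cuts_ge by (simp only: of_nat_le_iff)
  then show "real (card indep) \<le> st_unreliability arcs q s t * 2 ^ card (L \<union> R)"
    unfolding eq by (simp add: pos_le_divide_eq)
  show "st_unreliability arcs q s t * 2 ^ card (L \<union> R)
           \<le> real (card indep) + 2 ^ card (L \<union> R) * (3/4) ^ K"
    unfolding eq using card_cuts_le[OF K] by (simp add: pos_divide_le_eq algebra_simps)
qed

lemma acyclic_arcs: "acyclic arcs"
proof -
  \<comment> \<open>The layers are source, left, inner, right, sink, and every arc goes to a higher
    layer; the sink gets the default value 4.\<close>
  define rank where "rank v = (if v = s then 0 else if v \<in> old ` L then 1 else if v \<in> range mid then 2
    else if v \<in> old ` R then 3 else (4::nat))" for v
  have "arcs \<subseteq> inv_image less_than rank"
  proof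
    fix a assume "a \<in> arcs"
    then consider x where "x \<in> L" "a = (s, old x)" | y where "y \<in> R" "a = (old y, t)"
      | j where "j \<in> J" "a = (old (fst (edge j)), mid j)" | j where "j \<in> J" "a = (mid j, old (snd (edge j)))"
      by (auto simp: arcs_def side_def link_def)
    then show "a \<in> inv_image less_than rank"
    proof cases
      case 2
      then show ?thesis using disjoint by (auto simp: rank_def)
    next
      case 3
      then show ?thesis using edge[of j] by (auto simp: rank_def mem_Times_iff)
    next
      case 4
      then show ?thesis using edge[of j] disjoint by (auto simp: rank_def mem_Times_iff)
    qed (auto simp: rank_def)
  qed
  then show ?thesis
    by (meson acyclic_subset wf_acyclic wf_inv_image wf_less_than)
qed

end

section \<open>Composing programs\<close>

lemma run_add: "run (m + n) cfg = bind_pmf (run m cfg) (run n)"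
  by (induction m arbitrary: cfg) (auto simp: bind_return_pmf bind_assoc_pmf intro!: bind_pmf_cong)

lemma run_halted: "run n ([], \<sigma>) = return_pmf ([], \<sigma>)"
  by (induction n) (simp_all add: bind_return_pmf)

text \<open>A deterministic big-step relation: the step count is the same whatever lies below on the
  stack, so it composes. A bound in place of the exact count lets estimates be loosened by
  \<open>exec_mono\<close>.\<close>

definition exec :: "com \<Rightarrow> store \<Rightarrow> nat \<Rightarrow> store \<Rightarrow> bool" where
  "exec c \<sigma> B \<sigma>' \<longleftrightarrow> (\<exists>n\<le>B. \<forall>cs. run n (c # cs, \<sigma>) = return_pmf (cs, \<sigma>'))"

lemma execI: "(\<And>cs. run n (c # cs, \<sigma>) = return_pmf (cs, \<sigma>')) \<Longrightarrow> n \<le> B \<Longrightarrow> exec c \<sigma> B \<sigma>'"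
  unfolding exec_def by blast

lemma exec_mono: "exec c \<sigma> B \<sigma>' \<Longrightarrow> B \<le> B' \<Longrightarrow> exec c \<sigma> B' \<sigma>'"
  unfolding exec_def by (meson le_trans)

lemma exec_Assign: "exec (Assign x e) \<sigma> 1 (\<sigma>(x := eval_expr \<sigma> e))"
  by (rule execI[where n = 1]) (simp_all add: bind_return_pmf)

lemma exec_Seq:
  assumes "exec c1 \<sigma> A \<sigma>1" "exec c2 \<sigma>1 B \<sigma>2"
  shows "exec (Seq c1 c2) \<sigma> (Suc (A + B)) \<sigma>2"
proof -
  obtain m n where "m \<le> A" "\<And>cs. run m (c1 # cs, \<sigma>) = return_pmf (cs, \<sigma>1)"
    and "n \<le> B" "\<And>cs. run n (c2 # cs, \<sigma>1) = return_pmf (cs, \<sigma>2)"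
    using assms unfolding exec_def by auto
  then show ?thesis
    by (intro execI[where n = "Suc (m + n)"]) (simp_all add: run_add bind_return_pmf)
qed

lemma exec_If:
  assumes "exec (if eval_expr \<sigma> e \<noteq> Atom then c1 else c2) \<sigma> B \<sigma>'"
  shows "exec (If e c1 c2) \<sigma> (Suc B) \<sigma>'"
proof -
  obtain n where "n \<le> B" "\<And>cs. run n ((if eval_expr \<sigma> e \<noteq> Atom then c1 else c2) # cs, \<sigma>) = return_pmf (cs, \<sigma>')"
    using assms unfolding exec_def by auto
  then show ?thesis
    by (intro execI[where n = "Suc n"]) (auto simp: bind_return_pmf split: if_splits)
qed

lemma exec_While_end: "eval_expr \<sigma> e = Atom \<Longrightarrow> exec (While e c) \<sigma> 1 \<sigma>"
  by (rule execI[where n = 1]) (simp_all add: bind_return_pmf)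

lemma exec_While_step:
  assumes "eval_expr \<sigma> e \<noteq> Atom" "exec c \<sigma> A \<sigma>1" "exec (While e c) \<sigma>1 B \<sigma>2"
  shows "exec (While e c) \<sigma> (Suc (A + B)) \<sigma>2"
proof -
  obtain m n where "m \<le> A" "\<And>cs. run m (c # cs, \<sigma>) = return_pmf (cs, \<sigma>1)"
    and "n \<le> B" "\<And>cs. run n (While e c # cs, \<sigma>1) = return_pmf (cs, \<sigma>2)"
    using assms unfolding exec_def by auto
  then show ?thesis
    using assms(1) by (intro execI[where n = "Suc (m + n)"]) (simp_all add: run_add bind_return_pmf)
qed

text \<open>The language has no skip command; assigning variable 0 to itself takes its
  place.\<close>

fun block :: "(nat \<times> expr) list \<Rightarrow> com" where
  "block [] = Assign 0 (Var 0)"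
| "block ((x, e) # as) = Seq (Assign x e) (block as)"

lemma exec_block:
  "exec (block as) \<sigma> (2 * length as + 1) (fold (\<lambda>(x, e) \<sigma>. \<sigma>(x := eval_expr \<sigma> e)) as \<sigma>)"
proof (induction as arbitrary: \<sigma> rule: block.induct)
  case 1
  then show ?case using exec_Assign[of 0 "Var 0" \<sigma>] by simp
next
  case (2 x e as)
  show ?case using exec_Seq[OF exec_Assign 2] by simp
qed

definition for_each :: "nat \<Rightarrow> com \<Rightarrow> com" where
  "for_each x c = While (Var x) (Seq c (Assign x (Cdr (Var x))))"

text \<open>\<open>rep s as\<close> is the store with abstract state \<open>s\<close> and remaining
  list \<open>as\<close>. The body must leave the loop variable alone, which the update in
  \<open>body\<close> expresses; the loop then pops it. The 3 extra steps are the test, the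
  sequencing and the pop, and the final 1 is the failing test.\<close>

lemma exec_for_each:
  assumes x: "\<And>s as. rep s as x = enc_list f as"
    and body: "\<And>s a as. exec c (rep s (a # as)) B ((rep (F a s) as)(x := enc_list f (a # as)))"
  shows "exec (for_each x c) (rep s as) (length as * (B + 3) + 1) (rep (fold F as s) [])"
proof (induction as arbitrary: s)
  case Nil
  then show ?case unfolding for_each_def using exec_While_end[of "rep s []" "Var x"] x by simp
next
  case (Cons a as)
  have "(rep (F a s) as)(x := enc_list f as) = rep (F a s) as" by (auto simp: x)
  then have "exec (Seq c (Assign x (Cdr (Var x)))) (rep s (a # as)) (Suc (B + 1)) (rep (F a s) as)"
    using exec_Seq[OF body[of s a as] exec_Assign[of x "Cdr (Var x)"]] by simp
  from exec_While_step[OF _ this Cons[of "F a s", unfolded for_each_def]] show ?case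
    by (auto simp: x for_each_def elim!: exec_mono)
qed

text \<open>The time bound of the first program holds on every path, so after that many steps plus those
  of the continuation every path has halted, however early it left the first program.\<close>

lemma run_continue:
  assumes "\<And>cs' \<sigma>'. (cs', \<sigma>') \<in> set_pmf (run m (cs, \<sigma>)) \<Longrightarrow>
      cs' = [] \<and> run n (rest, \<sigma>') = return_pmf ([], g \<sigma>')"
  shows "run (m + n) (cs @ rest, \<sigma>) = map_pmf (\<lambda>(_, \<sigma>'). ([], g \<sigma>')) (run m (cs, \<sigma>))"
  using assms
proof (induction m arbitrary: cs \<sigma>)
  case 0
  then show ?case by simp
next
  case (Suc m)
  show ?case
  proof (cases cs)
    case Nil
    have "run n (rest, \<sigma>) = return_pmf ([], g \<sigma>)"
      using Suc.prems[of "[]" \<sigma>] unfolding Nil run_halted by simp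
    then have "run (n + Suc m) (rest, \<sigma>) = return_pmf ([], g \<sigma>)"
      by (simp only: run_add bind_return_pmf run_halted)
    then show ?thesis
      unfolding Nil run_halted by (simp add: add.commute)
  next
    case (Cons c cs')
    have "step (cs @ rest, \<sigma>) = map_pmf (\<lambda>(cs', \<sigma>'). (cs' @ rest, \<sigma>')) (step (cs, \<sigma>))"
      unfolding Cons by (cases c) (simp_all add: map_pmf_comp)
    then have "run (Suc m + n) (cs @ rest, \<sigma>) =
        bind_pmf (step (cs, \<sigma>)) (\<lambda>cfg. run (m + n) (fst cfg @ rest, snd cfg))"
      by (simp add: bind_map_pmf split_beta)
    also have "\<dots> = bind_pmf (step (cs, \<sigma>)) (\<lambda>cfg. map_pmf (\<lambda>(_, \<sigma>'). ([], g \<sigma>')) (run m cfg))"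
    proof (rule bind_pmf_cong[OF refl])
      fix cfg assume cfg: "cfg \<in> set_pmf (step (cs, \<sigma>))"
      obtain cs' \<sigma>' where eq: "cfg = (cs', \<sigma>')" by (cases cfg)
      have "run (m + n) (cs' @ rest, \<sigma>') = map_pmf (\<lambda>(_, \<sigma>'). ([], g \<sigma>')) (run m (cs', \<sigma>'))"
      proof (rule Suc.IH)
        fix cs'' \<sigma>'' assume "(cs'', \<sigma>'') \<in> set_pmf (run m (cs', \<sigma>'))"
        then have "(cs'', \<sigma>'') \<in> set_pmf (run (Suc m) (cs, \<sigma>))"
          using cfg eq by auto
        then show "cs'' = [] \<and> run n (rest, \<sigma>'') = return_pmf ([], g \<sigma>'')"
          by (rule Suc.prems)
      qed
      then show "run (m + n) (fst cfg @ rest, snd cfg) =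
          map_pmf (\<lambda>(_, \<sigma>'). ([], g \<sigma>')) (run m cfg)"
        by (simp add: eq)
    qed
    also have "\<dots> = map_pmf (\<lambda>(_, \<sigma>'). ([], g \<sigma>')) (run (Suc m) (cs, \<sigma>))"
      by (simp add: map_bind_pmf)
    finally show ?thesis .
  qed
qed

section \<open>Private variables out of the reach of a given program\<close>

primrec expr_bound :: "nat \<Rightarrow> expr \<Rightarrow> bool" where
  "expr_bound m (Var x) \<longleftrightarrow> x < m"
| "expr_bound m Nl \<longleftrightarrow> True"
| "expr_bound m (Cons e1 e2) \<longleftrightarrow> expr_bound m e1 \<and> expr_bound m e2"
| "expr_bound m (Car e) \<longleftrightarrow> expr_bound m e"
| "expr_bound m (Cdr e) \<longleftrightarrow> expr_bound m e"

primrec com_bound :: "nat \<Rightarrow> com \<Rightarrow> bool" where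
  "com_bound m (Assign x e) \<longleftrightarrow> x < m \<and> expr_bound m e"
| "com_bound m (Flip x) \<longleftrightarrow> x < m"
| "com_bound m (Seq c1 c2) \<longleftrightarrow> com_bound m c1 \<and> com_bound m c2"
| "com_bound m (If e c1 c2) \<longleftrightarrow> expr_bound m e \<and> com_bound m c1 \<and> com_bound m c2"
| "com_bound m (While e c) \<longleftrightarrow> expr_bound m e \<and> com_bound m c"

lemma expr_bound_mono: "expr_bound m e \<Longrightarrow> m \<le> m' \<Longrightarrow> expr_bound m' e"
  by (induction e) auto

lemma com_bound_mono: "com_bound m c \<Longrightarrow> m \<le> m' \<Longrightarrow> com_bound m' c"
  by (induction c) (auto intro: expr_bound_mono)

lemma ex_expr_bound: "\<exists>m. expr_bound m e"
proof (induction e)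
  case (Cons e1 e2)
  then obtain m1 m2 where "expr_bound m1 e1" "expr_bound m2 e2" by auto
  then have "expr_bound (max m1 m2) (Cons e1 e2)" by (auto intro: expr_bound_mono)
  then show ?case by blast
qed auto

lemma ex_com_bound: "\<exists>m. com_bound m c"
proof (induction c)
  case (Assign x e)
  obtain m where "expr_bound m e" using ex_expr_bound by blast
  then have "com_bound (max m (Suc x)) (Assign x e)" by (auto intro: expr_bound_mono)
  then show ?case by blast
next
  case (Flip x)
  then show ?case by auto
next
  case (Seq c1 c2)
  then obtain m1 m2 where "com_bound m1 c1" "com_bound m2 c2" by auto
  then have "com_bound (max m1 m2) (Seq c1 c2)" by (auto intro: com_bound_mono)
  then show ?case by blast
next
  case (If e c1 c2)
  then obtain m1 m2 m3 where "com_bound m1 c1" "com_bound m2 c2" "expr_bound m3 e"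
    using ex_expr_bound by metis
  then have "com_bound (max m1 (max m2 m3)) (If e c1 c2)"
    by (auto intro: com_bound_mono expr_bound_mono)
  then show ?case by blast
next
  case (While e c)
  then obtain m1 m2 where "com_bound m1 c" "expr_bound m2 e" using ex_expr_bound by metis
  then have "com_bound (max m1 m2) (While e c)" by (auto intro: com_bound_mono expr_bound_mono)
  then show ?case by blast
qed

text \<open>\<open>\<sigma>\<close> is the part of the store a program bounded by \<open>m\<close>
  can see; \<open>\<tau>\<close> holds the private data.\<close>

definition above :: "nat \<Rightarrow> store \<Rightarrow> store \<Rightarrow> store" where
  "above m \<tau> \<sigma> = (\<lambda>x. if x < m then \<sigma> x else \<tau> x)"

lemma eval_expr_above: "expr_bound m e \<Longrightarrow> eval_expr (above m \<tau> \<sigma>) e = eval_expr \<sigma> e"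
  by (induction e) (auto simp: above_def)

lemma above_upd: "x < m \<Longrightarrow> (above m \<tau> \<sigma>)(x := v) = above m \<tau> (\<sigma>(x := v))"
  by (auto simp: above_def)

text \<open>A frame property: variables from \<open>m\<close> on are neither read nor written. It
  transfers the guarantee for a fresh store to a store with leftovers.\<close>

lemma run_above:
  assumes "\<forall>c\<in>set cs. com_bound m c"
  shows "run n (cs, above m \<tau> \<sigma>) = map_pmf (\<lambda>(cs', \<sigma>'). (cs', above m \<tau> \<sigma>')) (run n (cs, \<sigma>))"
  using assms
proof (induction n arbitrary: cs \<sigma>)
  case 0
  then show ?case by simp
next
  case (Suc n)
  have step: "step (cs, above m \<tau> \<sigma>) = map_pmf (\<lambda>(cs', \<sigma>'). (cs', above m \<tau> \<sigma>')) (step (cs, \<sigma>))"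
    and bound: "\<forall>(cs', \<sigma>') \<in> set_pmf (step (cs, \<sigma>)). \<forall>c\<in>set cs'. com_bound m c"
    using Suc.prems
    by (cases "(cs, \<sigma>)" rule: step.cases;
        auto simp: eval_expr_above above_upd map_pmf_comp split: if_splits)+
  show ?case
    unfolding run.simps step bind_map_pmf map_bind_pmf
  proof (rule bind_pmf_cong[OF refl])
    fix cfg assume "cfg \<in> set_pmf (step (cs, \<sigma>))"
    then show "run n (case cfg of (cs', \<sigma>') \<Rightarrow> (cs', above m \<tau> \<sigma>')) =
        map_pmf (\<lambda>(cs', \<sigma>'). (cs', above m \<tau> \<sigma>')) (run n cfg)"
      using bound Suc.IH by (cases cfg) auto
  qed
qed

section \<open>Binary numerals\<close>

lemma enc_nat_0 [simp]: "enc_nat 0 = Atom"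
  by (simp add: enc_nat.simps)

lemma enc_nat_odd: "enc_nat (2 * n + 1) = Cell (Cell Atom Atom) (enc_nat n)"
  by (subst enc_nat.simps) (simp add: enc_bool_def)

lemma enc_nat_even: "n > 0 \<Longrightarrow> enc_nat (2 * n) = Cell Atom (enc_nat n)"
  by (subst enc_nat.simps) (simp add: enc_bool_def)

lemma enc_nat_1: "enc_nat 1 = Cell (Cell Atom Atom) Atom"
  using enc_nat_odd[of 0] by simp

lemma enc_nat_2: "enc_nat 2 = Cell Atom (Cell (Cell Atom Atom) Atom)"
  using enc_nat_even[of 1] unfolding enc_nat_1 by simp

lemma enc_nat_4: "enc_nat 4 = Cell Atom (Cell Atom (Cell (Cell Atom Atom) Atom))"
  using enc_nat_even[of 2] by (simp add: enc_nat_2)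

lemma enc_nat_eq_Atom: "enc_nat n = Atom \<longleftrightarrow> n = 0"
  by (subst enc_nat.simps) simp

text \<open>A number is thereby also an encoded list, so a loop can walk along its digits.\<close>

fun bits :: "nat \<Rightarrow> bool list" where
  "bits n = (if n = 0 then [] else odd n # bits (n div 2))"

declare bits.simps [simp del]

lemma enc_nat_bits: "enc_nat n = enc_list enc_bool (bits n)"
proof (induction n rule: less_induct)
  case (less n)
  then show ?case by (subst enc_nat.simps, subst bits.simps) simp
qed

lemma less_two_power_bits: "n < 2 ^ length (bits n)"
proof (induction n rule: less_induct)
  case (less n)
  show ?case
  proof (cases "n = 0")
    case False
    then have "n div 2 < 2 ^ length (bits (n div 2))" by (intro less) simp
    moreover have "length (bits n) = Suc (length (bits (n div 2)))"
      using False by (subst bits.simps) simp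
    ultimately show ?thesis by simp
  qed simp
qed

section \<open>The reduced instance\<close>

text \<open>Later paths come first because the program conses new arcs to the front of its
  accumulator; \<open>c\<close> is the exponent of the next inner vertex.\<close>

fun path_arcs :: "nat \<Rightarrow> (nat \<times> nat) list \<Rightarrow> ((nat \<times> nat) \<times> fraction) list" where
  "path_arcs c [] = []"
| "path_arcs c (e # es) = path_arcs (Suc c) es
     @ [((2 * fst e + 1, 2 ^ c), (1, 2)), ((2 ^ c, 2 * snd e + 1), (1, 2))]"

fun path_verts :: "nat \<Rightarrow> 'e list \<Rightarrow> nat list" where
  "path_verts c [] = []"
| "path_verts c (e # es) = path_verts (Suc c) es @ [2 ^ c]"

definition copies :: "nat \<Rightarrow> 'a list \<Rightarrow> 'a list" where
  "copies k es = concat (map (replicate k) es)"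

text \<open>A vertex \<open>x\<close> of the bipartite graph becomes \<open>2 * x + 1\<close>, the source is \<open>0\<close>, the sink is \<open>2\<close>, and
  the inner vertices of the paths of length two are \<open>4, 8, 16, \<dots>\<close>. Thus all names are obtained by
  prepending digits, and the program needs no arithmetic.\<close>

definition reduced_instance :: "nat \<Rightarrow> bipartite_instance \<Rightarrow> st_instance" where
  "reduced_instance k B =
     \<lparr>st_verts = path_verts 2 (copies k (bip_edges B)) @ rev (map (\<lambda>y. 2 * y + 1) (bip_right B))
        @ rev (map (\<lambda>x. 2 * x + 1) (bip_left B)) @ [0, 2],
      st_arcs = path_arcs 2 (copies k (bip_edges B)) @ rev (map (\<lambda>y. ((2 * y + 1, 2), (1, 2))) (bip_right B))
        @ rev (map (\<lambda>x. ((0, 2 * x + 1), (1, 2))) (bip_left B)),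
      st_source = 0, st_sink = 2\<rparr>"

lemma length_copies: "length (copies k es) = length es * k"
  by (induction es) (auto simp: copies_def)

lemma set_copies: "k > 0 \<Longrightarrow> set (copies k es) = set es"
  by (auto simp: copies_def)

lemma count_copies:
  "e \<in> set es \<Longrightarrow> k \<le> card {j. j < length (copies k es) \<and> copies k es ! j = e}"
proof -
  have "e \<in> set es \<Longrightarrow> k \<le> length (filter (\<lambda>a. a = e) (copies k es))"
    by (induction es) (auto simp: copies_def)
  then show "e \<in> set es \<Longrightarrow> ?thesis" by (simp add: length_filter_conv_card)
qed

lemma path_arcs_append: "path_arcs c (xs @ ys) = path_arcs (c + length xs) ys @ path_arcs c xs"
  by (induction xs arbitrary: c) auto

lemma path_verts_append: "path_verts c (xs @ ys) = path_verts (c + length xs) ys @ path_verts c xs"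
  by (induction xs arbitrary: c) auto

lemma length_path_arcs: "length (path_arcs c es) = 2 * length es"
  by (induction es arbitrary: c) auto

lemma length_path_verts: "length (path_verts c es) = length es"
  by (induction es arbitrary: c) auto

lemma path_verts_eq: "path_verts c es = rev (map (\<lambda>j. 2 ^ j) [c..<c + length es])"
  by (induction es arbitrary: c) (auto simp: upt_rec)

lemma snd_path_arcs: "a \<in> set (path_arcs c es) \<Longrightarrow> snd a = (1, 2)"
  by (induction es arbitrary: c) auto

lemma set_path_arcs:
  "fst ` set (path_arcs c es) =
     (\<Union>j\<in>{..<length es}. {(2 * fst (es ! j) + 1, 2 ^ (c + j)), (2 ^ (c + j), 2 * snd (es ! j) + 1)})"
proof (induction es arbitrary: c)
  case (Cons e es)
  then show ?case by (auto simp: lessThan_Suc_eq_insert_0 image_Un)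
qed simp

locale reduced =
  fixes k :: nat and B :: bipartite_instance
  assumes B: "B \<in> bipartite_instances" and k: "k > 0"
begin

abbreviation "es \<equiv> copies k (bip_edges B)"

text \<open>The exponents start at 2 because \<open>2 ^ 0\<close> is odd, hence the name of a
  bipartite vertex, and \<open>2 ^ 1\<close> is the sink.\<close>

sublocale net: bundle_network "set (bip_left B)" "set (bip_right B)" "{..<length es}" "\<lambda>j. es ! j"
  "0 :: nat" "2 :: nat" "\<lambda>x. 2 * x + 1" "\<lambda>j. 2 ^ (2 + j)"
proof
  show "set (bip_left B) \<inter> set (bip_right B) = {}"
    using B by (simp add: bipartite_instances_def)
  show "es ! j \<in> set (bip_left B) \<times> set (bip_right B)" if "j \<in> {..<length es}" for j
  proof -
    have "es ! j \<in> set (bip_edges B)" using that set_copies[OF k] by (metis lessThan_iff nth_mem)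
    then show ?thesis using B by (auto simp: bipartite_instances_def)
  qed
  show "(2::nat) \<noteq> 2 ^ (2 + j)" for j by (auto simp: power_add)
  show "2 * x + 1 \<noteq> (2::nat) ^ (2 + j)" for x j
  proof
    assume eq: "2 * x + 1 = (2::nat) ^ (2 + j)"
    have "even (2 * x + 1)" unfolding eq by simp
    then show False by simp
  qed
  show "(2::nat) \<noteq> 2 * x + 1" for x by presburger
qed (auto simp: inj_def)

lemma edges_eq: "(\<lambda>j. es ! j) ` {..<length es} = set (bip_edges B)"
  using set_copies[OF k, of "bip_edges B"] by (auto simp: set_conv_nth)

lemma arcs_eq: "arc_set (reduced_instance k B) = net.arcs"
proof -
  have *: "(L \<union> R) \<inter> L = L" "(L \<union> R) \<inter> R = R" for L R :: "nat set" by auto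
  show ?thesis
    unfolding arc_set_def reduced_instance_def net.arcs_def net.side_def net.link_def *
    by (auto simp: image_Un set_path_arcs image_image)
qed

lemma card_verts:
  "card (set (bip_left B) \<union> set (bip_right B)) = length (bip_left B) + length (bip_right B)"
  using B by (auto simp: bipartite_instances_def card_Un_disjoint distinct_card)

lemma arcs_half: "a \<in> set (st_arcs (reduced_instance k B)) \<Longrightarrow> snd a = (1, 2)"
  unfolding reduced_instance_def by (auto dest: snd_path_arcs)

text \<open>The arc list has as many entries as the network has arcs, a number already computed, so
  no entry repeats.\<close>

lemma distinct_arcs: "distinct (map fst (st_arcs (reduced_instance k B)))"
proof (rule card_distinct)
  have "card (set (map fst (st_arcs (reduced_instance k B)))) = card net.arcs"
    using arcs_eq by (simp add: arc_set_def)
  also have "\<dots> = length (map fst (st_arcs (reduced_instance k B)))"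
    unfolding net.card_arcs card_verts by (simp add: reduced_instance_def length_path_arcs)
  finally show "card (set (map fst (st_arcs (reduced_instance k B)))) = \<dots>" .
qed

lemma distinct_verts: "distinct (st_verts (reduced_instance k B))"
proof -
  have "distinct (bip_left B)" "distinct (bip_right B)" "set (bip_left B) \<inter> set (bip_right B) = {}"
    using B by (auto simp: bipartite_instances_def)
  moreover have "2 ^ j \<noteq> 2 * x + 1" "2 * x + 1 \<noteq> 2 ^ j" "2 ^ j \<noteq> (2 :: nat)" if j: "2 \<le> j" for j x :: nat
  proof -
    obtain i where "j = 2 + i" using le_Suc_ex[OF j] by blast
    then show "2 ^ j \<noteq> 2 * x + 1" "2 * x + 1 \<noteq> 2 ^ j" "2 ^ j \<noteq> (2 :: nat)"
      using net.names(6)[of x i] net.names(5)[of i] by auto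
  qed
  moreover have "Suc (2 * x) \<noteq> 2" "2 \<noteq> Suc (2 * x)" for x by presburger+
  moreover obtain N where "path_verts 2 es = rev (map (\<lambda>j. 2 ^ j) [2..<N])"
    using path_verts_eq by blast
  ultimately show ?thesis
    unfolding reduced_instance_def by (auto simp: distinct_map inj_on_def)
qed

lemma fail_prob_half:
  assumes "e \<in> net.arcs"
  shows "fail_prob (reduced_instance k B) e = 1/2"
proof -
  obtain r where r: "(e, r) \<in> set (st_arcs (reduced_instance k B))"
    using assms unfolding arcs_eq[symmetric] arc_set_def by auto
  then have "r = (1, 2)" using arcs_half by fastforce
  with r show ?thesis
    using distinct_arcs by (simp add: fail_prob_def frac_val_def)
qed

lemma uniform_dag: "reduced_instance k B \<in> uniform_dag_instances"
proof -
  let ?G = "reduced_instance k B"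
  have "arc_set ?G \<subseteq> set (st_verts ?G) \<times> set (st_verts ?G)"
  proof -
    have "{2 * fst (es ! j) + 1, 2 * snd (es ! j) + 1} \<subseteq> set (st_verts ?G)"
      if "j < length es" for j
      using net.edge[of j] that by (auto simp: reduced_instance_def mem_Times_iff)
    moreover have "2 ^ (2 + j) \<in> set (st_verts ?G)" if "j < length es" for j
    proof -
      have "2 ^ (2 + j) \<in> (\<lambda>j. 2 ^ j) ` {2..<2 + length es}"
        by (rule imageI) (use that in simp)
      then show ?thesis
        unfolding reduced_instance_def path_verts_eq st_instance.simps set_append set_rev set_map set_upt
        by blast
    qed
    moreover have "0 \<in> set (st_verts ?G)" "2 \<in> set (st_verts ?G)"
      "x \<in> set (bip_left B) \<union> set (bip_right B) \<Longrightarrow> 2 * x + 1 \<in> set (st_verts ?G)" for x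
      by (auto simp: reduced_instance_def)
    ultimately show ?thesis
      unfolding arcs_eq net.arcs_def net.side_def net.link_def by auto
  qed
  moreover have "valid_fraction r \<and> frac_val r \<in> {0..1}" if "(e, r) \<in> set (st_arcs ?G)" for e r
    using arcs_half[OF that] by (simp add: valid_fraction_def frac_val_def)
  moreover have "st_source ?G \<in> set (st_verts ?G)" "st_sink ?G \<in> set (st_verts ?G)"
    by (simp_all add: reduced_instance_def)
  ultimately have "?G \<in> dag_instances"
    unfolding dag_instances_def valid_st_instance_def
    using distinct_arcs distinct_verts net.acyclic_arcs arcs_eq by auto
  moreover have "\<forall>e\<in>arc_set ?G. fail_prob ?G e = 1/2"
    using fail_prob_half unfolding arcs_eq by blast
  ultimately show ?thesis unfolding uniform_dag_instances_def by blast
qed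

lemma unreliability_bounds:
  defines "n \<equiv> length (bip_left B) + length (bip_right B)"
  shows "num_BIS B \<le> unreliability (reduced_instance k B) * 2 ^ n"
    and "unreliability (reduced_instance k B) * 2 ^ n \<le> num_BIS B + 2 ^ n * (3/4) ^ k"
proof -
  have K: "k \<le> card {j \<in> {..<length es}. es ! j = e}" if "e \<in> (\<lambda>j. es ! j) ` {..<length es}" for e
    using count_copies[of e "bip_edges B" k] that unfolding edges_eq by simp
  have st: "st_source (reduced_instance k B) = 0" "st_sink (reduced_instance k B) = 2"
    by (simp_all add: reduced_instance_def)
  show "num_BIS B \<le> unreliability (reduced_instance k B) * 2 ^ n"
    and "unreliability (reduced_instance k B) * 2 ^ n \<le> num_BIS B + 2 ^ n * (3/4) ^ k"
    using net.st_unreliability_bounds[OF fail_prob_half K]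
    unfolding unreliability_def num_BIS_def arcs_eq st card_verts edges_eq n_def by simp_all
qed

end

text \<open>As \<open>N\<close> is at least 1, the absolute error \<open>\<eta>\<close> is at most
  \<open>\<eta> * N\<close>. Above, the factor \<open>(1 + \<epsilon> / 2) * (1 + \<eta>)\<close> is
  at most \<open>1 + \<epsilon> / 2 + \<epsilon> / 4 + \<epsilon> / 8\<close>.\<close>

lemma approximates_scaled:
  fixes \<epsilon> \<eta> r U N :: real
  assumes r: "(1 - \<epsilon> / 2) * U \<le> r" "r \<le> (1 + \<epsilon> / 2) * U" "0 \<le> r"
    and U: "N \<le> U * 2 ^ n" "U * 2 ^ n \<le> N + \<eta>"
    and N: "1 \<le> N" and \<eta>: "0 \<le> \<eta>" "\<eta> \<le> 1/4" "\<eta> \<le> \<epsilon> / 4" and \<epsilon>: "0 < \<epsilon>"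
  shows "(1 - \<epsilon>) * N \<le> r * 2 ^ n" "r * 2 ^ n \<le> (1 + \<epsilon>) * N"
proof -
  show "(1 - \<epsilon>) * N \<le> r * 2 ^ n"
  \<comment> \<open>An FPRAS must accept every positive error bound. For large ones
    \<open>1 - \<epsilon> / 2\<close> may be negative and the chain of inequalities breaks, but then
    the lower bound is trivial.\<close>
  proof (cases "\<epsilon> \<le> 1")
    case True
    have "(1 - \<epsilon>) * N \<le> (1 - \<epsilon> / 2) * N" using N \<epsilon> by (intro mult_right_mono) auto
    also have "\<dots> \<le> (1 - \<epsilon> / 2) * (U * 2 ^ n)" using U True by (intro mult_left_mono) auto
    also have "\<dots> = (1 - \<epsilon> / 2) * U * 2 ^ n" by simp
    also have "\<dots> \<le> r * 2 ^ n" using r by (intro mult_right_mono) auto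
    finally show ?thesis .
  next
    case False
    then have "(1 - \<epsilon>) * N \<le> 0" using N by (intro mult_nonpos_nonneg) auto
    also have "\<dots> \<le> r * 2 ^ n" using r by simp
    finally show ?thesis .
  qed
  have "r * 2 ^ n \<le> (1 + \<epsilon> / 2) * U * 2 ^ n" using r by (intro mult_right_mono) auto
  also have "\<dots> = (1 + \<epsilon> / 2) * (U * 2 ^ n)" by simp
  also have "\<dots> \<le> (1 + \<epsilon> / 2) * (N + \<eta> * N)"
  proof (rule mult_left_mono)
    have "\<eta> * 1 \<le> \<eta> * N" using N \<eta> by (intro mult_left_mono) auto
    with U show "U * 2 ^ n \<le> N + \<eta> * N" by simp
  qed (use \<epsilon> in simp)
  also have "\<dots> = ((1 + \<epsilon> / 2) * (1 + \<eta>)) * N" by (simp add: algebra_simps)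
  also have "\<dots> \<le> (1 + \<epsilon>) * N"
  proof (rule mult_right_mono)
    have "\<epsilon> * \<eta> \<le> \<epsilon> * (1/4)" using \<eta> \<epsilon> by (intro mult_left_mono) auto
    moreover have "(1 + \<epsilon> / 2) * (1 + \<eta>) = 1 + \<epsilon> / 2 + \<eta> + (\<epsilon> * \<eta>) / 2"
      by (simp add: algebra_simps)
    ultimately show "(1 + \<epsilon> / 2) * (1 + \<eta>) \<le> 1 + \<epsilon>" using \<eta> \<epsilon> by linarith
  qed (use N in simp)
  finally show "r * 2 ^ n \<le> (1 + \<epsilon>) * N" .
qed

text \<open>Three paths more than halve the error, since \<open>(3/4) ^ 3 = 27/64\<close>. One
  halving per vertex cancels \<open>2 ^ n\<close>, one per digit beats \<open>1 / d\<close>, and two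
  more give the factor 1/4.\<close>

definition path_count :: "bipartite_instance \<Rightarrow> nat \<Rightarrow> nat" where
  "path_count B d = 3 * (length (bip_left B) + length (bip_right B) + length (bits d) + 2)"

lemma one_le_num_BIS: "1 \<le> num_BIS B"
proof -
  let ?I = "independent_sets (set (bip_left B) \<union> set (bip_right B)) (set (bip_edges B))"
  have "{} \<in> ?I" by (auto simp: independent_sets_def)
  moreover have "finite ?I"
    by (rule finite_subset[of _ "Pow (set (bip_left B) \<union> set (bip_right B))"])
      (auto simp: independent_sets_def)
  ultimately have "card ?I \<noteq> 0" by auto
  then show ?thesis by (simp add: num_BIS_def)
qed

lemma reduction_error:
  assumes "d > 0"
  shows "2 ^ (length (bip_left B) + length (bip_right B)) * (3/4 :: real) ^ path_count B d \<le> 1 / (4 * real d)"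
proof -
  define n b where "n = length (bip_left B) + length (bip_right B)" and "b = length (bits d)"
  have "(3/4 :: real) ^ path_count B d = ((3/4) ^ 3) ^ (n + b + 2)"
    by (simp only: path_count_def n_def b_def power_mult)
  also have "\<dots> \<le> (1/2) ^ (n + b + 2)" by (rule power_mono) (simp_all add: power3_eq_cube)
  finally have "2 ^ n * (3/4 :: real) ^ path_count B d \<le> 2 ^ n * (1/2) ^ (n + b + 2)" by simp
  also have "\<dots> = 1 / (4 * 2 ^ b)" by (simp add: power_add power_one_over field_simps)
  also have "\<dots> \<le> 1 / (4 * real d)"
  proof -
    have "real d \<le> real (2 ^ b)" using less_two_power_bits[of d] unfolding b_def of_nat_le_iff by simp
    then show ?thesis using assms by (intro divide_left_mono) auto
  qed
  finally show ?thesis by (simp add: n_def)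
qed

section \<open>The program\<close>

text \<open>Loop counters in unary need only consing and popping.\<close>

definition unary :: "nat \<Rightarrow> sexp" where
  "unary n = enc_list (\<lambda>_. Atom) (replicate n ())"

lemma unary_0 [simp]: "unary 0 = Atom"
  by (simp add: unary_def)

lemma unary_Suc [simp]: "unary (Suc n) = Cell Atom (unary n)"
  by (simp add: unary_def)

definition odd_expr :: "expr \<Rightarrow> expr" where
  "odd_expr e = Cons (Cons Nl Nl) e"

definition two_expr :: expr where
  "two_expr = Cons Nl (odd_expr Nl)"

definition arc_expr :: "expr \<Rightarrow> expr \<Rightarrow> expr" where
  "arc_expr e1 e2 = Cons (Cons e1 e2) (Cons (odd_expr Nl) two_expr)"

abbreviation enc_arc :: "(nat \<times> nat) \<times> fraction \<Rightarrow> sexp" where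
  "enc_arc \<equiv> enc_pair (enc_pair enc_nat enc_nat) enc_fraction"

lemma eval_odd_expr: "eval_expr \<sigma> e = enc_nat x \<Longrightarrow> eval_expr \<sigma> (odd_expr e) = enc_nat (2 * x + 1)"
  unfolding enc_nat_odd by (simp add: odd_expr_def)

lemma eval_two_expr: "eval_expr \<sigma> two_expr = enc_nat 2"
  by (simp add: two_expr_def odd_expr_def enc_nat_2)

lemma eval_arc_expr:
  "eval_expr \<sigma> e1 = enc_nat x \<Longrightarrow> eval_expr \<sigma> e2 = enc_nat y \<Longrightarrow>
   eval_expr \<sigma> (arc_expr e1 e2) = enc_arc ((x, y), (1, 2))"
  using enc_nat_1 by (simp add: arc_expr_def eval_two_expr odd_expr_def enc_fraction_def)

text \<open>The variables from \<open>m\<close> on are: the list traversed by the outer loops, the counter of the inner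
  loop, the number \<open>n\<close> of vertices and the number \<open>k\<close> of paths per edge (both in unary), the vertices and
  the arcs produced so far, and the next fresh vertex.\<close>

definition state ::
  "nat \<Rightarrow> sexp \<Rightarrow> sexp \<Rightarrow> sexp \<Rightarrow> nat \<Rightarrow> nat \<Rightarrow> nat list \<Rightarrow> ((nat \<times> nat) \<times> fraction) list \<Rightarrow> nat \<Rightarrow> store" where
  "state m v x j n k V A c = (\<lambda>_. Atom)(0 := v, m := x, m + 1 := j, m + 2 := unary n, m + 3 := unary k,
     m + 4 := enc_list enc_nat V, m + 5 := enc_list enc_arc A, m + 6 := enc_nat (2 ^ c))"

definition incr3 :: "expr \<Rightarrow> expr" where
  "incr3 e = Cons Nl (Cons Nl (Cons Nl e))"

definition vertex_body :: "nat \<Rightarrow> expr \<Rightarrow> com" where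
  "vertex_body m a = block
     [(m + 4, Cons (odd_expr (Car (Var m))) (Var (m + 4))),
      (m + 5, Cons a (Var (m + 5))),
      (m + 2, Cons Nl (Var (m + 2))),
      (m + 3, incr3 (Var (m + 3)))]"

definition path_body :: "nat \<Rightarrow> com" where
  "path_body m = block
     [(m + 4, Cons (Var (m + 6)) (Var (m + 4))),
      (m + 5, Cons (arc_expr (odd_expr (Car (Car (Var m)))) (Var (m + 6)))
        (Cons (arc_expr (Var (m + 6)) (odd_expr (Cdr (Car (Var m))))) (Var (m + 5)))),
      (m + 6, Cons Nl (Var (m + 6)))]"

text \<open>The counter in \<open>m + 3\<close> starts at 6 and grows by 3 per left vertex, right
  vertex and denominator digit, which totals \<open>path_count\<close>. The last block puts a digit
  0 in front of the denominator, which halves the error bound.\<close>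

definition prepare :: "nat \<Rightarrow> com" where
  "prepare m =
     Seq (block [(m + 4, Cons Nl (Cons two_expr Nl)), (m + 6, Cons Nl two_expr),
                 (m + 3, incr3 (incr3 Nl)), (m, Car (Car (Var 0)))])
    (Seq (for_each m (vertex_body m (arc_expr Nl (odd_expr (Car (Var m))))))
    (Seq (block [(m, Car (Cdr (Car (Var 0))))])
    (Seq (for_each m (vertex_body m (arc_expr (odd_expr (Car (Var m))) two_expr)))
    (Seq (block [(m, Cdr (Cdr (Var 0)))])
    (Seq (for_each m (block [(m + 3, incr3 (Var (m + 3)))]))
    (Seq (block [(m, Cdr (Cdr (Car (Var 0))))])
    (Seq (for_each m (Seq (block [(m + 1, Var (m + 3))]) (for_each (m + 1) (path_body m))))
         (block [(0, Cons (Cons (Var (m + 4)) (Cons (Var (m + 5)) (Cons Nl two_expr)))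
                          (Cons (Car (Cdr (Var 0))) (Cons Nl (Cdr (Cdr (Var 0))))))]))))))))"

section \<open>Correctness and running time of the preparation\<close>

lemma exec_block_eq:
  assumes "fold (\<lambda>(x, e) \<sigma>. \<sigma>(x := eval_expr \<sigma> e)) as \<sigma> = \<sigma>'" "2 * length as + 1 \<le> B"
  shows "exec (block as) \<sigma> B \<sigma>'"
  using exec_block[of as \<sigma>] assms exec_mono by blast

text \<open>One lemma serves both sides, with the arc given by \<open>a\<close>. The hypothesis on
  \<open>a\<close> ranges over all stores because \<open>a\<close> is evaluated after
  \<open>m + 4\<close> has already changed.\<close>

lemma exec_vertices:
  assumes m: "m > 0"
    and a: "\<And>\<sigma> x. car (\<sigma> m) = enc_nat x \<Longrightarrow> eval_expr \<sigma> a = enc_arc (f x)"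
  shows "exec (for_each m (vertex_body m a)) (state m v (enc_list enc_nat xs) j n k V A c)
    (length xs * 12 + 1)
    (state m v Atom j (length xs + n) (3 * length xs + k) (rev (map (\<lambda>x. 2 * x + 1) xs) @ V)
      (rev (map f xs) @ A) c)"
proof -
  let ?rep = "\<lambda>(n, k, V, A) as. state m v (enc_list enc_nat as) j n k V A c"
  let ?F = "\<lambda>x (n, k, V, A). (Suc n, 3 + k, (2 * x + 1) # V, f x # A)"
  have "exec (for_each m (vertex_body m a)) (?rep (n, k, V, A) xs) (length xs * (9 + 3) + 1)
      (?rep (fold ?F xs (n, k, V, A)) [])"
  proof (rule exec_for_each)
    show "?rep s as m = enc_list enc_nat as" for s as
      using m by (auto simp: state_def split: prod.splits)
    show "exec (vertex_body m a) (?rep s (x # as)) 9 ((?rep (?F x s) as)(m := enc_list enc_nat (x # as)))"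
      for s x as
      unfolding vertex_body_def
    proof (rule exec_block_eq)
      obtain n k V A where s: "s = (n, k, V, A)" by (metis prod_cases4)
      show "fold (\<lambda>(x, e) \<sigma>. \<sigma>(x := eval_expr \<sigma> e))
         [(m + 4, Cons (odd_expr (Car (Var m))) (Var (m + 4))), (m + 5, Cons a (Var (m + 5))),
          (m + 2, Cons Nl (Var (m + 2))), (m + 3, incr3 (Var (m + 3)))] (?rep s (x # as)) =
         (?rep (?F x s) as)(m := enc_list enc_nat (x # as))"
        using m unfolding s
        by (simp add: a[where x = x] eval_odd_expr[where x = x] state_def fun_eq_iff incr3_def eval_nat_numeral)
    qed simp
  qed
  moreover have "fold ?F xs (n, k, V, A) =
      (length xs + n, 3 * length xs + k, rev (map (\<lambda>x. 2 * x + 1) xs) @ V, rev (map f xs) @ A)"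
    by (induction xs arbitrary: n k V A) auto
  ultimately show ?thesis by simp
qed

lemma exec_digits:
  assumes m: "m > 0"
  shows "exec (for_each m (block [(m + 3, incr3 (Var (m + 3)))]))
    (state m v (enc_list f xs) j n k V A c) (length xs * 6 + 1)
    (state m v Atom j n (3 * length xs + k) V A c)"
proof -
  let ?rep = "\<lambda>k as. state m v (enc_list f as) j n k V A c"
  have "exec (for_each m (block [(m + 3, incr3 (Var (m + 3)))])) (?rep k xs) (length xs * (3 + 3) + 1)
      (?rep (fold (\<lambda>_ k. 3 + k) xs k) [])"
  proof (rule exec_for_each)
    show "?rep s as m = enc_list f as" for s as
      using m by (auto simp: state_def)
    show "exec (block [(m + 3, incr3 (Var (m + 3)))]) (?rep s (x # as)) 3
       ((?rep (3 + s) as)(m := enc_list f (x # as)))" for s x as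
      by (rule exec_block_eq) (use m in \<open>simp_all add: state_def fun_eq_iff incr3_def eval_nat_numeral\<close>)
  qed
  moreover have "fold (\<lambda>_ k. 3 + k) xs k = 3 * length xs + k"
    by (induction xs arbitrary: k) auto
  ultimately show ?thesis by simp
qed

lemma exec_paths:
  assumes m: "m > 0"
    and w: "w = Cell (enc_pair enc_nat enc_nat e) y"
  shows "exec (for_each (m + 1) (path_body m)) (state m v w (unary i) n k V A c) (i * 10 + 1)
    (state m v w Atom n k (path_verts c (replicate i e) @ V) (path_arcs c (replicate i e) @ A) (c + i))"
proof -
  let ?rep = "\<lambda>(V, A, c) (as :: unit list). state m v w (enc_list (\<lambda>_. Atom) as) n k V A c"
  let ?F = "\<lambda>_ (V, A, c). (2 ^ c # V, ((2 * fst e + 1, 2 ^ c), (1, 2))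
      # ((2 ^ c, 2 * snd e + 1), (1, 2)) # A, Suc c)"
  have "exec (for_each (m + 1) (path_body m)) (?rep (V, A, c) (replicate i ()))
      (length (replicate i ()) * (7 + 3) + 1) (?rep (fold ?F (replicate i ()) (V, A, c)) [])"
  proof (rule exec_for_each)
    show "?rep s as (m + 1) = enc_list (\<lambda>_. Atom) as" for s as
      using m by (auto simp: state_def split: prod.splits)
    show "exec (path_body m) (?rep s (x # as)) 7 ((?rep (?F x s) as)(m + 1 := enc_list (\<lambda>_. Atom) (x # as)))"
      for s x as
      unfolding path_body_def
    proof (rule exec_block_eq)
      obtain V A c where s: "s = (V, A, c)" by (metis prod_cases3)
      have w': "car (car w) = enc_nat (fst e)" "cdr (car w) = enc_nat (snd e)"
        using w by (cases e, simp)+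
      show "fold (\<lambda>(x, e) \<sigma>. \<sigma>(x := eval_expr \<sigma> e))
         [(m + 4, Cons (Var (m + 6)) (Var (m + 4))),
          (m + 5, Cons (arc_expr (odd_expr (Car (Car (Var m)))) (Var (m + 6)))
             (Cons (arc_expr (Var (m + 6)) (odd_expr (Cdr (Car (Var m))))) (Var (m + 5)))),
          (m + 6, Cons Nl (Var (m + 6)))] (?rep s (x # as)) =
         (?rep (?F x s) as)(m + 1 := enc_list (\<lambda>_. Atom) (x # as))"
        \<comment> \<open>Prepending a digit 0 to \<open>2 ^ c\<close> produces the next fresh inner
          vertex.\<close>
        using m w' enc_nat_even[of "2 ^ c"] unfolding s
        by (simp add: eval_arc_expr[where x = "2 * fst e + 1" and y = "2 ^ c"]
            eval_arc_expr[where x = "2 ^ c" and y = "2 * snd e + 1"]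
            eval_odd_expr[where x = "fst e"] eval_odd_expr[where x = "snd e"] state_def fun_eq_iff
            del: enc_pair.simps)
    qed simp
  qed
  moreover have "fold ?F (replicate i ()) (V, A, c) =
      (path_verts c (replicate i e) @ V, path_arcs c (replicate i e) @ A, c + i)"
    by (induction i arbitrary: V A c) auto
  ultimately show ?thesis by (simp add: unary_def)
qed

lemma exec_edges:
  assumes m: "m > 0"
  shows "exec (for_each m (Seq (block [(m + 1, Var (m + 3))]) (for_each (m + 1) (path_body m))))
    (state m v (enc_list (enc_pair enc_nat enc_nat) es) Atom n k V A c) (length es * (k * 10 + 8) + 1)
    (state m v Atom Atom n k (path_verts c (copies k es) @ V) (path_arcs c (copies k es) @ A)
      (c + length es * k))"
proof -
  let ?rep = "\<lambda>(V, A, c) as. state m v (enc_list (enc_pair enc_nat enc_nat) as) Atom n k V A c"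
  \<comment> \<open>The exponent \<open>c\<close> is threaded through all edges, so inner vertices
    of different edges never coincide.\<close>
  let ?F = "\<lambda>e (V, A, c). (path_verts c (replicate k e) @ V, path_arcs c (replicate k e) @ A, c + k)"
  let ?c = "Seq (block [(m + 1, Var (m + 3))]) (for_each (m + 1) (path_body m))"
  have "exec (for_each m ?c) (?rep (V, A, c) es)
      (length es * (Suc (3 + (k * 10 + 1)) + 3) + 1) (?rep (fold ?F es (V, A, c)) [])"
  proof (rule exec_for_each)
    show "?rep s as m = enc_list (enc_pair enc_nat enc_nat) as" for s as
      using m by (auto simp: state_def split: prod.splits)
    show "exec ?c (?rep s (e # as)) (Suc (3 + (k * 10 + 1)))
       ((?rep (?F e s) as)(m := enc_list (enc_pair enc_nat enc_nat) (e # as)))" for s e as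
    proof -
      obtain V A c where s: "s = (V, A, c)" by (metis prod_cases3)
      let ?w = "enc_list (enc_pair enc_nat enc_nat) (e # as)"
      have 1: "exec (block [(m + 1, Var (m + 3))]) (?rep s (e # as)) 3 (state m v ?w (unary k) n k V A c)"
        by (rule exec_block_eq) (use m in \<open>simp_all add: s state_def fun_eq_iff\<close>)
      have 2: "exec (for_each (m + 1) (path_body m)) (state m v ?w (unary k) n k V A c) (k * 10 + 1)
          (state m v ?w Atom n k (path_verts c (replicate k e) @ V) (path_arcs c (replicate k e) @ A) (c + k))"
        by (rule exec_paths[OF m]) simp
      have 3: "state m v ?w Atom n k (path_verts c (replicate k e) @ V) (path_arcs c (replicate k e) @ A) (c + k)
          = (?rep (?F e s) as)(m := ?w)"
        using m by (simp add: s state_def fun_eq_iff)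
      show ?thesis using exec_Seq[OF 1 2] unfolding 3 .
    qed
  qed
  moreover have "fold ?F es (V, A, c) =
      (path_verts c (copies k es) @ V, path_arcs c (copies k es) @ A, c + length es * k)"
    by (induction es arbitrary: V A c) (auto simp: copies_def path_verts_append path_arcs_append)
  ultimately show ?thesis by (auto elim!: exec_mono)
qed

definition prepare_time :: "bipartite_instance \<Rightarrow> nat \<Rightarrow> nat" where
  "prepare_time B d = 100 * (1 + length (bip_left B) + length (bip_right B) + length (bits d)
     + length (bip_edges B) * (path_count B d + 1))"

text \<open>\<open>V\<close>, \<open>A\<close> and \<open>c\<close> are hidden because what follows
  uses only the new input in variable 0 and the unary \<open>n\<close>, kept for the final
  scaling.\<close>

lemma exec_prepare:
  fixes B p
  assumes m: "m > 0" and d: "d > 0"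
  defines "v \<equiv> Cell (enc_bipartite_instance B) (enc_fraction (p, d))"
    and "k \<equiv> path_count B d" and "n \<equiv> length (bip_left B) + length (bip_right B)"
  shows "\<exists>V A c. exec (prepare m) ((\<lambda>_. Atom)(0 := v)) (prepare_time B d)
    (state m (Cell (enc_st_instance (reduced_instance k B)) (enc_fraction (p, 2 * d))) Atom Atom n k V A c)"
proof -
  let ?L = "bip_left B" and ?R = "bip_right B" and ?E = "bip_edges B"
  let ?l = "length ?L" and ?r = "length ?R" and ?b = "length (bits d)"
  let ?AL = "rev (map (\<lambda>x. ((0, 2 * x + 1), (1, 2))) ?L)" and ?VL = "rev (map (\<lambda>x. 2 * x + 1) ?L) @ [0, 2]"
  let ?AR = "rev (map (\<lambda>y. ((2 * y + 1, 2), (1, 2))) ?R) @ ?AL" and ?VR = "rev (map (\<lambda>x. 2 * x + 1) ?R) @ ?VL"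
  let ?v' = "Cell (enc_st_instance (reduced_instance k B)) (enc_fraction (p, 2 * d))"
  have v: "car (car v) = enc_list enc_nat ?L" "car (cdr (car v)) = enc_list enc_nat ?R"
    "cdr (cdr v) = enc_list enc_bool (bits d)" "cdr (cdr (car v)) = enc_list (enc_pair enc_nat enc_nat) ?E"
    "car (cdr v) = enc_nat p" "cdr (cdr v) = enc_nat d"
    by (simp_all add: v_def enc_bipartite_instance_def enc_fraction_def enc_nat_bits)
  have s1: "exec (block [(m + 4, Cons Nl (Cons two_expr Nl)), (m + 6, Cons Nl two_expr),
        (m + 3, incr3 (incr3 Nl)), (m, Car (Car (Var 0)))]) ((\<lambda>_. Atom)(0 := v)) 9
      (state m v (enc_list enc_nat ?L) Atom 0 6 [0, 2] [] 2)"
    by (rule exec_block_eq)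
      (use m enc_nat_4 enc_nat_2 in \<open>simp_all add: v state_def fun_eq_iff incr3_def eval_two_expr numeral_eq_Suc\<close>)
  have s2: "exec (for_each m (vertex_body m (arc_expr Nl (odd_expr (Car (Var m))))))
      (state m v (enc_list enc_nat ?L) Atom 0 6 [0, 2] [] 2) (?l * 12 + 1)
      (state m v Atom Atom ?l (3 * ?l + 6) ?VL ?AL 2)"
    using exec_vertices[OF m, where f = "\<lambda>x. ((0, 2 * x + 1), (1, 2))" and n = 0 and A = "[]"]
    by (simp add: eval_arc_expr[where x = 0] eval_odd_expr)
  have s3: "exec (block [(m, Car (Cdr (Car (Var 0))))]) (state m v Atom Atom ?l (3 * ?l + 6) ?VL ?AL 2) 3
      (state m v (enc_list enc_nat ?R) Atom ?l (3 * ?l + 6) ?VL ?AL 2)"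
    by (rule exec_block_eq) (use m in \<open>simp_all add: v state_def fun_eq_iff\<close>)
  have s4: "exec (for_each m (vertex_body m (arc_expr (odd_expr (Car (Var m))) two_expr)))
      (state m v (enc_list enc_nat ?R) Atom ?l (3 * ?l + 6) ?VL ?AL 2) (?r * 12 + 1)
      (state m v Atom Atom (?r + ?l) (3 * ?r + (3 * ?l + 6)) ?VR ?AR 2)"
    by (rule exec_vertices[OF m, where f = "\<lambda>y. ((2 * y + 1, 2), (1, 2))"])
      (simp add: eval_arc_expr eval_odd_expr eval_two_expr)
  have s5: "exec (block [(m, Cdr (Cdr (Var 0)))])
      (state m v Atom Atom (?r + ?l) (3 * ?r + (3 * ?l + 6)) ?VR ?AR 2) 3
      (state m v (enc_list enc_bool (bits d)) Atom (?r + ?l) (3 * ?r + (3 * ?l + 6)) ?VR ?AR 2)"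
    by (rule exec_block_eq) (use m v(3) in \<open>simp_all add: state_def fun_eq_iff\<close>)
  have k: "3 * ?b + (3 * ?r + (3 * ?l + 6)) = k" "?r + ?l = n"
    by (simp_all add: k_def n_def path_count_def)
  have s6: "exec (for_each m (block [(m + 3, incr3 (Var (m + 3)))]))
      (state m v (enc_list enc_bool (bits d)) Atom (?r + ?l) (3 * ?r + (3 * ?l + 6)) ?VR ?AR 2)
      (?b * 6 + 1) (state m v Atom Atom n k ?VR ?AR 2)"
    using exec_digits[OF m] unfolding k(1)[symmetric] k(2)[symmetric] by blast
  have s7: "exec (block [(m, Cdr (Cdr (Car (Var 0))))]) (state m v Atom Atom n k ?VR ?AR 2) 3
      (state m v (enc_list (enc_pair enc_nat enc_nat) ?E) Atom n k ?VR ?AR 2)"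
    by (rule exec_block_eq) (use m in \<open>simp_all add: v state_def fun_eq_iff\<close>)
  let ?V = "path_verts 2 (copies k ?E) @ ?VR" and ?A = "path_arcs 2 (copies k ?E) @ ?AR"
    and ?c = "2 + length ?E * k"
  note s8 = exec_edges[OF m, of v ?E n k ?VR ?AR 2]
  have G: "enc_st_instance (reduced_instance k B) =
      Cell (enc_list enc_nat ?V) (Cell (enc_list enc_arc ?A) (Cell Atom (enc_nat 2)))"
    by (simp add: enc_st_instance_def reduced_instance_def)
  have s9: "exec (block [(0, Cons (Cons (Var (m + 4)) (Cons (Var (m + 5)) (Cons Nl two_expr)))
        (Cons (Car (Cdr (Var 0))) (Cons Nl (Cdr (Cdr (Var 0))))))])
      (state m v Atom Atom n k ?V ?A ?c) 3 (state m ?v' Atom Atom n k ?V ?A ?c)"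
  proof (rule exec_block_eq)
    have "eval_expr (state m v Atom Atom n k ?V ?A ?c)
        (Cons (Cons (Var (m + 4)) (Cons (Var (m + 5)) (Cons Nl two_expr)))
          (Cons (Car (Cdr (Var 0))) (Cons Nl (Cdr (Cdr (Var 0)))))) = ?v'"
      unfolding G using m d v(5,6) enc_nat_even[of d]
      by (simp add: state_def eval_two_expr enc_fraction_def)
    then show "fold (\<lambda>(x, e) \<sigma>. \<sigma>(x := eval_expr \<sigma> e))
       [(0, Cons (Cons (Var (m + 4)) (Cons (Var (m + 5)) (Cons Nl two_expr)))
         (Cons (Car (Cdr (Var 0))) (Cons Nl (Cdr (Cdr (Var 0))))))] (state m v Atom Atom n k ?V ?A ?c)
       = state m ?v' Atom Atom n k ?V ?A ?c"
      using m by (simp add: state_def fun_eq_iff del: eval_expr.simps)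
  qed simp
  note s = exec_Seq[OF s1 exec_Seq[OF s2 exec_Seq[OF s3 exec_Seq[OF s4 exec_Seq[OF s5
      exec_Seq[OF s6 exec_Seq[OF s7 exec_Seq[OF s8 s9]]]]]]]]
  have "exec (prepare m) ((\<lambda>_. Atom)(0 := v)) (prepare_time B d) (state m ?v' Atom Atom n k ?V ?A ?c)"
    unfolding prepare_def by (rule exec_mono[OF s]) (simp add: prepare_time_def add_mult_distrib2 flip: k_def)
  then show ?thesis by blast
qed

text \<open>Each digit 0 prepended to the numerator doubles it. A zero numerator must be left alone:
  a digit 0 in front of \<open>Atom\<close> is not a valid numeral.\<close>

definition rescale :: "nat \<Rightarrow> com" where
  "rescale m = If (Car (Var 0))
     (for_each (m + 2) (block [(0, Cons (Cons Nl (Car (Var 0))) (Cdr (Var 0)))])) (block [])"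

text \<open>Total on trees, since a failed run of the scheme may output something that is not a
  fraction.\<close>

definition shift :: "nat \<Rightarrow> sexp \<Rightarrow> sexp" where
  "shift n s = (if car s = Atom then s else ((\<lambda>s. Cell (Cell Atom (car s)) (cdr s)) ^^ n) s)"

lemma shift_enc_fraction: "shift n (enc_fraction (a, b)) = enc_fraction (2 ^ n * a, b)"
proof (cases "a = 0")
  case False
  have "((\<lambda>s. Cell (Cell Atom (car s)) (cdr s)) ^^ n) (enc_fraction (a, b)) = enc_fraction (2 ^ n * a, b)"
  proof (induction n)
    case (Suc n)
    then show ?case using enc_nat_even[of "2 ^ n * a"] False by (simp add: enc_fraction_def mult.assoc)
  qed simp
  then show ?thesis using False by (simp add: shift_def enc_fraction_def enc_nat_eq_Atom)
qed (simp add: shift_def enc_fraction_def)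

lemma exec_rescale:
  assumes "\<sigma> (m + 2) = unary n"
  shows "exec (rescale m) \<sigma> (6 * n + 2)
    (if car (\<sigma> 0) = Atom then \<sigma> else \<sigma>(0 := shift n (\<sigma> 0), m + 2 := Atom))"
proof (cases "car (\<sigma> 0) = Atom")
  case True
  have "exec (block []) \<sigma> 1 \<sigma>" using exec_block[of "[]" \<sigma>] by simp
  then have "exec (rescale m) \<sigma> (Suc 1) \<sigma>"
    unfolding rescale_def using True by (intro exec_If) simp
  then show ?thesis using True by (auto elim!: exec_mono)
next
  case False
  let ?rep = "\<lambda>s (as :: unit list). \<sigma>(0 := s, m + 2 := enc_list (\<lambda>_. Atom) as)"
  let ?F = "\<lambda>s. Cell (Cell Atom (car s)) (cdr s)"
  have "exec (for_each (m + 2) (block [(0, Cons (Cons Nl (Car (Var 0))) (Cdr (Var 0)))]))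
      (?rep (\<sigma> 0) (replicate n ())) (length (replicate n ()) * (3 + 3) + 1)
      (?rep (fold (\<lambda>_. ?F) (replicate n ()) (\<sigma> 0)) [])"
  proof (rule exec_for_each)
    show "exec (block [(0, Cons (Cons Nl (Car (Var 0))) (Cdr (Var 0)))]) (?rep s (a # as)) 3
        ((?rep (?F s) as)(m + 2 := enc_list (\<lambda>_. Atom) (a # as)))" for s a as
      by (rule exec_block_eq) (simp_all add: fun_eq_iff)
  qed simp
  moreover have "fold (\<lambda>_. ?F) (replicate n ()) s = (?F ^^ n) s" for s
    by (induction n arbitrary: s) (simp_all add: funpow_Suc_right del: funpow.simps(2))
  moreover have "?rep (\<sigma> 0) (replicate n ()) = \<sigma>"
    using assms by (simp add: unary_def fun_eq_iff)
  ultimately have "exec (rescale m) \<sigma> (Suc (n * 6 + 1)) (\<sigma>(0 := (?F ^^ n) (\<sigma> 0), m + 2 := Atom))"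
    unfolding rescale_def using False by (intro exec_If) simp
  then show ?thesis using False by (auto simp: shift_def elim!: exec_mono)
qed

section \<open>The composed program\<close>

definition reduction :: "nat \<Rightarrow> com \<Rightarrow> com" where
  "reduction m P = Seq (prepare m) (Seq P (rescale m))"

lemma exec_run: "exec c \<sigma> B \<sigma>' \<Longrightarrow> run B ([c], \<sigma>) = return_pmf ([], \<sigma>')"
proof -
  assume "exec c \<sigma> B \<sigma>'"
  then obtain n where "n \<le> B" "run n ([c], \<sigma>) = return_pmf ([], \<sigma>')"
    unfolding exec_def by auto
  then have "run (n + (B - n)) ([c], \<sigma>) = return_pmf ([], \<sigma>')"
    unfolding run_add by (simp add: bind_return_pmf run_halted)
  then show ?thesis using \<open>n \<le> B\<close> by simp
qed

lemma run_Seq: "run (Suc n) (Seq c1 c2 # cs, \<sigma>) = run n (c1 # c2 # cs, \<sigma>)"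
  by (simp add: bind_return_pmf)

text \<open>After \<open>prepare\<close> the store agrees below \<open>m\<close> with a fresh one
  holding \<open>v'\<close>, so \<open>run_above\<close> applies to \<open>P\<close>;
  \<open>run_continue\<close> then attaches \<open>rescale\<close>, whose counter \<open>P\<close>
  could not touch.\<close>

lemma run_reduction:
  fixes B p
  assumes P: "com_bound m P" and m: "m > 0" and d: "d > 0"
  defines "v \<equiv> Cell (enc_bipartite_instance B) (enc_fraction (p, d))"
    and "v' \<equiv> Cell (enc_st_instance (reduced_instance (path_count B d) B)) (enc_fraction (p, 2 * d))"
    and "n \<equiv> length (bip_left B) + length (bip_right B)"
  assumes T: "halts_within P v' T"
  obtains T' where "T' \<le> T + prepare_time B d + 6 * n + 4" "halts_within (reduction m P) v T'"
    "output_pmf (reduction m P) v T' = map_pmf (shift n) (output_pmf P v' T)"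
proof -
  obtain V A c where
    "exec (prepare m) ((\<lambda>_. Atom)(0 := v)) (prepare_time B d) (state m v' Atom Atom n (path_count B d) V A c)"
    using exec_prepare[OF m d, of B p] unfolding v_def v'_def n_def by blast
  moreover define \<tau> where "\<tau> = state m v' Atom Atom n (path_count B d) V A c"
  moreover have "\<tau> = above m \<tau> ((\<lambda>_. Atom)(0 := v'))"
    using m by (auto simp: \<tau>_def state_def above_def fun_eq_iff)
  ultimately obtain t where t: "t \<le> prepare_time B d"
    "\<And>cs. run t (prepare m # cs, (\<lambda>_. Atom)(0 := v)) = return_pmf (cs, above m \<tau> ((\<lambda>_. Atom)(0 := v')))"
    unfolding exec_def by metis
  define g where "g \<sigma> = (if car (\<sigma> 0) = Atom then \<sigma> else \<sigma>(0 := shift n (\<sigma> 0), m + 2 := Atom))"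
    for \<sigma> :: store
  have g0: "g \<sigma> 0 = shift n (\<sigma> 0)" for \<sigma>
    by (simp add: g_def shift_def)
  have runP: "run T ([P], above m \<tau> ((\<lambda>_. Atom)(0 := v'))) =
      map_pmf (\<lambda>(cs, \<sigma>). (cs, above m \<tau> \<sigma>)) (run T (start P v'))"
    unfolding start_def using P by (intro run_above) simp
  have "run (T + (6 * n + 2)) ([P] @ [rescale m], above m \<tau> ((\<lambda>_. Atom)(0 := v'))) =
      map_pmf (\<lambda>(_, \<sigma>). ([], g \<sigma>)) (run T ([P], above m \<tau> ((\<lambda>_. Atom)(0 := v'))))"
  proof (rule run_continue)
    fix cs \<sigma> assume "(cs, \<sigma>) \<in> set_pmf (run T ([P], above m \<tau> ((\<lambda>_. Atom)(0 := v'))))"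
    then obtain \<sigma>0 where "(cs, \<sigma>0) \<in> set_pmf (run T (start P v'))" "\<sigma> = above m \<tau> \<sigma>0"
      unfolding runP by auto
    moreover from this have "\<sigma> (m + 2) = unary n"
      by (simp add: above_def \<tau>_def state_def)
    ultimately show "cs = [] \<and> run (6 * n + 2) ([rescale m], \<sigma>) = return_pmf ([], g \<sigma>)"
      using T exec_run[OF exec_rescale] unfolding halts_within_def g_def by blast
  qed
  also have "\<dots> = map_pmf (\<lambda>(_, \<sigma>). ([], g (above m \<tau> \<sigma>))) (run T (start P v'))"
    unfolding runP by (simp add: map_pmf_comp case_prod_unfold)
  finally have run: "run (Suc (t + Suc (T + (6 * n + 2)))) (start (reduction m P) v) =
      map_pmf (\<lambda>(_, \<sigma>). ([], g (above m \<tau> \<sigma>))) (run T (start P v'))"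
    unfolding start_def reduction_def run_Seq run_add[of t] t(2) bind_return_pmf by simp
  show thesis
  proof
    show "Suc (t + Suc (T + (6 * n + 2))) \<le> T + prepare_time B d + 6 * n + 4" using t(1) by simp
    show "halts_within (reduction m P) v (Suc (t + Suc (T + (6 * n + 2))))"
      unfolding halts_within_def run by auto
    have "above m \<tau> \<sigma> 0 = \<sigma> 0" for \<sigma> using m by (simp add: above_def)
    then show "output_pmf (reduction m P) v (Suc (t + Suc (T + (6 * n + 2))))
        = map_pmf (shift n) (output_pmf P v' T)"
      unfolding output_pmf_def run by (simp add: map_pmf_comp case_prod_unfold g0)
  qed
qed

lemma approximates_shift:
  assumes B: "B \<in> bipartite_instances" and p: "p > 0" and d: "d > 0"
    and out: "approximates (frac_val (p, 2 * d)) (unreliability (reduced_instance (path_count B d) B)) out"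
  shows "approximates (frac_val (p, d)) (num_BIS B)
    (shift (length (bip_left B) + length (bip_right B)) out)"
proof -
  let ?n = "length (bip_left B) + length (bip_right B)" and ?\<epsilon> = "frac_val (p, d)"
  let ?U = "unreliability (reduced_instance (path_count B d) B)"
  let ?\<eta> = "2 ^ ?n * (3/4 :: real) ^ path_count B d"
  interpret reduced "path_count B d" B
    by unfold_locales (use B in \<open>auto simp: path_count_def\<close>)
  have half: "frac_val (p, 2 * d) = ?\<epsilon> / 2" by (simp add: frac_val_def)
  obtain a b where ab: "b > 0" "out = enc_fraction (a, b)"
    "(1 - ?\<epsilon> / 2) * ?U \<le> frac_val (a, b)" "frac_val (a, b) \<le> (1 + ?\<epsilon> / 2) * ?U"
    using out unfolding half approximates_def valid_fraction_def by auto
  \<comment> \<open>With \<open>p\<close> at least 1 the error bound is at least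
    \<open>1 / d\<close>, so an error of \<open>1 / (4 * d)\<close> meets both requirements of
    \<open>approximates_scaled\<close>.\<close>
  have "1 / (4 * real d) \<le> 1/4" using d by simp
  moreover have "1 / (4 * real d) \<le> ?\<epsilon> / 4"
    using p d by (simp add: frac_val_def field_simps)
  ultimately have "?\<eta> \<le> 1/4" "?\<eta> \<le> ?\<epsilon> / 4"
    using reduction_error[OF d, of B] by linarith+
  moreover have "?\<epsilon> > 0" using p d by (simp add: frac_val_def)
  moreover have "0 \<le> frac_val (a, b)" by (simp add: frac_val_def)
  moreover have "0 \<le> ?\<eta>" by simp
  ultimately have "(1 - ?\<epsilon>) * num_BIS B \<le> frac_val (a, b) * 2 ^ ?n"
    "frac_val (a, b) * 2 ^ ?n \<le> (1 + ?\<epsilon>) * num_BIS B"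
    using approximates_scaled[OF ab(3,4) _ unreliability_bounds one_le_num_BIS] by blast+
  moreover have "frac_val (a, b) * 2 ^ ?n = frac_val (2 ^ ?n * a, b)"
    by (simp add: frac_val_def)
  ultimately show ?thesis
    unfolding approximates_def ab(2) shift_enc_fraction
    using ab(1) by (intro exI[of _ "(2 ^ ?n * a, b)"]) (simp add: valid_fraction_def)
qed

section \<open>Polynomial bounds\<close>

lemma length_le_size: "length xs \<le> size (enc_list f xs)"
  by (induction xs) auto

lemma size_mem_le: "x \<in> set xs \<Longrightarrow> size (f x) \<le> size (enc_list f xs)"
  by (induction xs) auto

lemma size_enc_list_le: "(\<And>x. x \<in> set xs \<Longrightarrow> size (f x) \<le> b) \<Longrightarrow> size (enc_list f xs) \<le> length xs * (b + 1)"
proof (induction xs)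
  case (Cons x xs)
  have "size (f x) \<le> b" "size (enc_list f xs) \<le> length xs * (b + 1)"
    using Cons by auto
  then show ?case by simp
qed simp

lemma size_enc_nat_odd: "size (enc_nat (2 * x + 1)) = size (enc_nat x) + 2"
  unfolding enc_nat_odd by simp

lemma size_enc_nat_power: "size (enc_nat (2 ^ c)) = c + 2"
proof (induction c)
  case 0
  then show ?case using enc_nat_1 by simp
next
  case (Suc c)
  then show ?case using enc_nat_even[of "2 ^ c"] by simp
qed

lemma size_enc_arc: "size (enc_arc ((x, y), (1, 2))) = size (enc_nat x) + size (enc_nat y) + 8"
  using enc_nat_1 by (simp add: enc_fraction_def enc_nat_2)

text \<open>The 12 is 2 for the digit making a name odd, 2 for a power of two beyond its exponent,
  and 8 for the rest of the arc.\<close>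

lemma size_path_arcs:
  assumes "a \<in> set (path_arcs c es)" "c + length es \<le> N"
    and "\<And>e. e \<in> set es \<Longrightarrow> size (enc_nat (fst e)) \<le> s \<and> size (enc_nat (snd e)) \<le> s"
  shows "size (enc_arc a) \<le> s + N + 12"
  using assms
proof (induction es arbitrary: c)
  case (Cons e es)
  have e: "size (enc_nat (fst e)) \<le> s" "size (enc_nat (snd e)) \<le> s"
    using Cons.prems(3)[of e] by auto
  from Cons.prems(1) consider "a \<in> set (path_arcs (Suc c) es)"
    | "a = ((2 * fst e + 1, 2 ^ c), (1, 2))" | "a = ((2 ^ c, 2 * snd e + 1), (1, 2))" by auto
  then show ?case
  proof cases
    case 1
    then show ?thesis using Cons.prems by (intro Cons.IH) auto
  next
    case 2
    show ?thesis unfolding 2 size_enc_arc size_enc_nat_odd size_enc_nat_power using e Cons.prems(2) by simp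
  next
    case 3
    show ?thesis unfolding 3 size_enc_arc size_enc_nat_odd size_enc_nat_power using e Cons.prems(2) by simp
  qed
qed simp

text \<open>The number of paths per edge is linear in \<open>S\<close>, so there are
  O(\<open>S ^ 2\<close>) paths. The inner names have exponents of that order, hence as many digits;
  lists of O(\<open>S ^ 2\<close>) entries of that size give the fourth power.\<close>

lemma reduction_size:
  fixes B p d
  assumes d: "d > 0"
  defines "S \<equiv> size (Cell (enc_bipartite_instance B) (enc_fraction (p, d)))"
  shows "size (Cell (enc_st_instance (reduced_instance (path_count B d) B)) (enc_fraction (p, 2 * d)))
           \<le> 1000 * S ^ 4"
    and "prepare_time B d + 6 * (length (bip_left B) + length (bip_right B)) + 4 \<le> 2000 * S ^ 4"
proof -
  let ?L = "bip_left B" and ?R = "bip_right B" and ?E = "bip_edges B"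
  define l r e b k where "l = length ?L" and "r = length ?R" and "e = length ?E"
    and "b = length (bits d)" and "k = path_count B d"
  define S2 where "S2 = S * S"
  have S: "S = size (enc_list enc_nat ?L) + size (enc_list enc_nat ?R)
      + size (enc_list (enc_pair enc_nat enc_nat) ?E) + size (enc_nat p) + size (enc_nat d) + 4"
    by (simp add: S_def enc_bipartite_instance_def enc_fraction_def)
  have len: "l \<le> size (enc_list enc_nat ?L)" "r \<le> size (enc_list enc_nat ?R)"
    "e \<le> size (enc_list (enc_pair enc_nat enc_nat) ?E)" "b \<le> size (enc_nat d)"
    unfolding l_def r_def e_def b_def enc_nat_bits by (rule length_le_size)+
  have lrb: "l + r + b \<le> S" and e: "e \<le> S" and S4: "4 \<le> S" using len S by auto
  have S2: "4 * S \<le> S2" "16 \<le> S2"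
    using S4 mult_le_mono[OF S4 S4] unfolding S2_def by auto
  have k: "k \<le> 5 * S" using lrb S4 by (simp add: k_def path_count_def l_def r_def b_def)
  have k0: "k > 0" by (simp add: k_def path_count_def)
  have ek: "e * k \<le> 5 * S2" using mult_le_mono[OF e k] by (simp add: S2_def)
  have S4_eq: "S ^ 4 = S2 * S2" by (simp add: S2_def power4_eq_xxxx mult.assoc)
  have S2_le: "S2 \<le> S2 * S2" using S2 by simp
  have sL: "size (enc_nat x) \<le> S" if "x \<in> set ?L" for x
    using size_mem_le[OF that, of enc_nat] S by simp
  have sR: "size (enc_nat x) \<le> S" if "x \<in> set ?R" for x
    using size_mem_le[OF that, of enc_nat] S by simp
  have sE: "size (enc_nat (fst x)) \<le> S \<and> size (enc_nat (snd x)) \<le> S" if "x \<in> set ?E" for x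
    using size_mem_le[OF that, of "enc_pair enc_nat enc_nat"] S by (cases x) simp
  let ?G = "reduced_instance k B"
  have two: "size (enc_nat 2) = 3" using size_enc_nat_power[of 1] by simp
  have "size (enc_nat x) \<le> 6 * S2" if "x \<in> set (st_verts ?G)" for x
  proof -
    from that consider y where "x = 2 * y + 1" "y \<in> set ?L \<or> y \<in> set ?R" | "x = 0" | "x = 2"
      | j where "x = 2 ^ j" "j < 2 + e * k"
      unfolding reduced_instance_def path_verts_eq length_copies e_def by force
    then show ?thesis
    proof cases
      case 1
      then have "size (enc_nat y) \<le> S" using sL sR by auto
      then show ?thesis unfolding 1(1) size_enc_nat_odd using S2 S4 by simp
    next
      case 4
      then show ?thesis unfolding 4(1) size_enc_nat_power using ek S2 by linarith
    qed (use two S2 in auto)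
  qed
  then have "size (enc_list enc_nat (st_verts ?G)) \<le> length (st_verts ?G) * (6 * S2 + 1)"
    by (rule size_enc_list_le)
  also have "length (st_verts ?G) = e * k + r + l + 2"
    by (simp add: reduced_instance_def length_path_verts length_copies e_def r_def l_def)
  also have "(e * k + r + l + 2) * (6 * S2 + 1) \<le> (6 * S2) * (7 * S2)"
    using ek lrb S2 S4 by (intro mult_le_mono) linarith+
  finally have V: "size (enc_list enc_nat (st_verts ?G)) \<le> 42 * (S2 * S2)" by simp
  have "size (enc_arc a) \<le> 9 * S2" if "a \<in> set (st_arcs ?G)" for a
  proof -
    from that consider y where "a = ((2 * y + 1, 2), (1, 2))" "y \<in> set ?R"
      | x where "a = ((0, 2 * x + 1), (1, 2))" "x \<in> set ?L"
      | "a \<in> set (path_arcs 2 (copies k ?E))"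
      unfolding reduced_instance_def by auto
    then show ?thesis
    proof cases
      case 1
      then show ?thesis
        unfolding 1(1) size_enc_arc size_enc_nat_odd two using sR[of y] S2 by simp
    next
      case 2
      then show ?thesis
        unfolding 2(1) size_enc_arc size_enc_nat_odd using sL[of x] S2 by simp
    next
      case 3
      have "size (enc_arc a) \<le> S + (2 + e * k) + 12"
        by (rule size_path_arcs[OF 3]) (use sE in \<open>auto simp: set_copies[OF k0] length_copies e_def\<close>)
      then show ?thesis using ek S2 by linarith
    qed
  qed
  then have "size (enc_list enc_arc (st_arcs ?G)) \<le> length (st_arcs ?G) * (9 * S2 + 1)"
    by (rule size_enc_list_le)
  also have "length (st_arcs ?G) = 2 * (e * k) + r + l"
    by (simp add: reduced_instance_def length_path_arcs length_copies e_def r_def l_def)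
  also have "(2 * (e * k) + r + l) * (9 * S2 + 1) \<le> (11 * S2) * (10 * S2)"
    using ek lrb S2 S4 by (intro mult_le_mono) linarith+
  finally have A: "size (enc_list enc_arc (st_arcs ?G)) \<le> 110 * (S2 * S2)" by simp
  have "size (enc_nat p) + size (enc_nat (2 * d)) \<le> S"
    using S d enc_nat_even[of d] by simp
  moreover have "st_source ?G = 0" "st_sink ?G = 2" by (simp_all add: reduced_instance_def)
  ultimately have "size (Cell (enc_st_instance ?G) (enc_fraction (p, 2 * d)))
      \<le> 42 * (S2 * S2) + 110 * (S2 * S2) + S + 10"
    using V A two by (simp add: enc_st_instance_def enc_fraction_def)
  also have "\<dots> \<le> 1000 * S ^ 4" unfolding S4_eq using S2 S2_le by linarith
  finally show "size (Cell (enc_st_instance (reduced_instance (path_count B d) B)) (enc_fraction (p, 2 * d)))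
           \<le> 1000 * S ^ 4"
    unfolding k_def .
  have "prepare_time B d = 100 * (1 + (l + r + b) + e * k + e)"
    by (simp add: prepare_time_def l_def r_def b_def e_def k_def)
  also have "\<dots> \<le> 100 * (1 + S + 5 * S2 + S)"
    using ek lrb e by (intro mult_left_mono add_mono) auto
  finally have "prepare_time B d + 6 * (l + r) + 4 \<le> 100 * (1 + S + 5 * S2 + S) + 6 * S + 4"
    using lrb by (intro add_mono mult_left_mono) auto
  also have "\<dots> \<le> 2000 * S2" using S2 by simp
  also have "\<dots> \<le> 2000 * (S2 * S2)" using S2_le by simp
  finally have "prepare_time B d + 6 * (l + r) + 4 \<le> 2000 * (S2 * S2)" .
  then show "prepare_time B d + 6 * (length (bip_left B) + length (bip_right B)) + 4 \<le> 2000 * S ^ 4"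
    unfolding S4_eq l_def r_def .
qed

text \<open>\<open>\<delta>\<close> is the reciprocal of the error bound, doubled for the scheme;
  1002 is 1000 for its input plus this 2. The exponent \<open>4 * k\<close> comes from its running
  time on an input of quartic size, and the added 4 covers the overhead.\<close>

lemma polynomial_composition:
  fixes X \<delta> :: real and S S' T T' t C k :: nat
  assumes X: "X = real S + \<delta>" and S: "1 \<le> S" and \<delta>: "0 < \<delta>"
    and S': "S' \<le> 1000 * S ^ 4" and t: "t \<le> 2000 * S ^ 4"
    and T: "real T \<le> real C * (real S' + 2 * \<delta>) ^ k" and T': "T' \<le> T + t"
  shows "real T' \<le> real (C * 1002 ^ k + 2000) * X ^ (4 * k + 4)"
proof -
  have "1 \<le> real S" using S by simp
  then have X1: "1 \<le> X" using X \<delta> by linarith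
  have "real S \<le> X" "\<delta> \<le> X" using X \<delta> by auto
  have S4: "real S ^ 4 \<le> X ^ 4" using \<open>real S \<le> X\<close> by (intro power_mono) auto
  have "X ^ 1 \<le> X ^ 4" using X1 by (intro power_increasing) auto
  then have "\<delta> \<le> X ^ 4" using \<open>\<delta> \<le> X\<close> by simp
  have "real S' \<le> real (1000 * S ^ 4)" "real t \<le> real (2000 * S ^ 4)"
    using S' t unfolding of_nat_le_iff by auto
  then have *: "real S' \<le> 1000 * X ^ 4" "real t \<le> 2000 * X ^ 4" using S4 by auto
  have "real S' + 2 * \<delta> \<le> 1002 * X ^ 4" using * \<open>\<delta> \<le> X ^ 4\<close> by linarith
  then have "(real S' + 2 * \<delta>) ^ k \<le> (1002 * X ^ 4) ^ k" using \<delta> by (intro power_mono) auto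
  also have "\<dots> = 1002 ^ k * X ^ (4 * k)" by (simp add: power_mult_distrib power_mult)
  also have "\<dots> \<le> 1002 ^ k * X ^ (4 * k + 4)" using X1 by (intro mult_left_mono power_increasing) auto
  finally have "real C * (real S' + 2 * \<delta>) ^ k \<le> real C * (1002 ^ k * X ^ (4 * k + 4))"
    by (intro mult_left_mono) auto
  moreover have "X ^ 4 \<le> X ^ (4 * k + 4)" using X1 by (intro power_increasing) auto
  moreover have "real T' \<le> real T + real t" using T' by linarith
  ultimately have "real T' \<le> real C * (1002 ^ k * X ^ (4 * k + 4)) + 2000 * X ^ (4 * k + 4)"
    using T * by linarith
  then show ?thesis by (simp add: algebra_simps)
qed

theorem BIS_FPRAS_of_uniform_unreliability_FPRAS:
  assumes "has_FPRAS enc_st_instance uniform_dag_instances unreliability"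
  shows "has_FPRAS enc_bipartite_instance bipartite_instances num_BIS"
proof -
  obtain P where "is_FPRAS enc_st_instance uniform_dag_instances unreliability P"
    using assms unfolding has_FPRAS_def by blast
  then obtain C k where P: "\<And>G \<epsilon>. G \<in> uniform_dag_instances \<Longrightarrow> valid_fraction \<epsilon> \<Longrightarrow> frac_val \<epsilon> > 0 \<Longrightarrow>
      \<exists>T. real T \<le> real C * (real (size (Cell (enc_st_instance G) (enc_fraction \<epsilon>))) + 1 / frac_val \<epsilon>) ^ k \<and>
        halts_within P (Cell (enc_st_instance G) (enc_fraction \<epsilon>)) T \<and>
        measure_pmf.prob (output_pmf P (Cell (enc_st_instance G) (enc_fraction \<epsilon>)) T)
          {out. approximates (frac_val \<epsilon>) (unreliability G) out} \<ge> 3/4"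
    unfolding is_FPRAS_def Let_def by blast
  obtain m0 where "com_bound m0 P" using ex_com_bound by blast
  then have m: "com_bound (Suc m0) P" "Suc m0 > 0" using com_bound_mono by auto
  have "is_FPRAS enc_bipartite_instance bipartite_instances num_BIS (reduction (Suc m0) P)"
    unfolding is_FPRAS_def Let_def
  proof (rule exI[of _ "C * 1002 ^ k + 2000"], rule exI[of _ "4 * k + 4"], intro ballI allI impI)
    fix B and \<epsilon> :: fraction
    assume B: "B \<in> bipartite_instances" and \<epsilon>: "valid_fraction \<epsilon> \<and> 0 < frac_val \<epsilon>"
    obtain p d where pd: "\<epsilon> = (p, d)" by (cases \<epsilon>)
    have d: "d > 0" and p: "p > 0"
      using \<epsilon> by (auto simp: pd valid_fraction_def frac_val_def zero_less_divide_iff)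
    let ?G = "reduced_instance (path_count B d) B" and ?n = "length (bip_left B) + length (bip_right B)"
    let ?v = "Cell (enc_bipartite_instance B) (enc_fraction \<epsilon>)"
    let ?v' = "Cell (enc_st_instance ?G) (enc_fraction (p, 2 * d))"
    interpret reduced "path_count B d" B
      by unfold_locales (use B in \<open>auto simp: path_count_def\<close>)
    have half: "frac_val (p, 2 * d) = frac_val \<epsilon> / 2" by (simp add: pd frac_val_def)
    \<comment> \<open>Halving the error bound doubles its reciprocal.\<close>
    obtain T where T: "real T \<le> real C * (real (size ?v') + 2 * (1 / frac_val \<epsilon>)) ^ k"
      "halts_within P ?v' T"
      "measure_pmf.prob (output_pmf P ?v' T) {out. approximates (frac_val (p, 2 * d)) (unreliability ?G) out} \<ge> 3/4"
      using P[OF uniform_dag, of "(p, 2 * d)"] \<epsilon> d unfolding half by (auto simp: valid_fraction_def)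
    obtain T' where T': "T' \<le> T + prepare_time B d + 6 * ?n + 4"
      "halts_within (reduction (Suc m0) P) ?v T'"
      "output_pmf (reduction (Suc m0) P) ?v T' = map_pmf (shift ?n) (output_pmf P ?v' T)"
      using run_reduction[OF m d T(2)] unfolding pd by blast
    have "real T' \<le> real (C * 1002 ^ k + 2000) * (real (size ?v) + 1 / frac_val \<epsilon>) ^ (4 * k + 4)"
    proof (rule polynomial_composition[OF refl _ _ _ _ T(1)])
      show "size ?v' \<le> 1000 * size ?v ^ 4" "prepare_time B d + 6 * ?n + 4 \<le> 2000 * size ?v ^ 4"
        using reduction_size[OF d, of B p] unfolding pd by auto
    qed (use T'(1) \<epsilon> in auto)
    moreover have "3/4 \<le> measure_pmf.prob (output_pmf (reduction (Suc m0) P) ?v T')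
        {out. approximates (frac_val \<epsilon>) (num_BIS B) out}"
    proof -
      \<comment> \<open>By \<open>approximates_shift\<close> the good outputs of the scheme lie in
        the preimage under \<open>shift ?n\<close> of the good final outputs, so the success
        probability carries over.\<close>
      have "measure_pmf.prob (output_pmf P ?v' T) {out. approximates (frac_val (p, 2 * d)) (unreliability ?G) out}
          \<le> measure_pmf.prob (output_pmf P ?v' T) (shift ?n -` {out. approximates (frac_val \<epsilon>) (num_BIS B) out})"
        using approximates_shift[OF B p d] unfolding pd by (intro measure_pmf.finite_measure_mono) auto
      then show ?thesis using T(3) unfolding T'(3) measure_map_pmf by linarith
    qed
    ultimately show "\<exists>T. real T \<le> real (C * 1002 ^ k + 2000) * (real (size ?v) + 1 / frac_val \<epsilon>) ^ (4 * k + 4) \<and>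
        halts_within (reduction (Suc m0) P) ?v T \<and>
        3/4 \<le> measure_pmf.prob (output_pmf (reduction (Suc m0) P) ?v T)
          {out. approximates (frac_val \<epsilon>) (num_BIS B) out}"
      using T'(2) by blast
  qed
  then show ?thesis unfolding has_FPRAS_def by blast
qed

text \<open>The same program works on a subclass; thus hardness for uniform failure probabilities
  yields hardness for all acyclic instances.\<close>

lemma has_FPRAS_subset: "has_FPRAS enc I f \<Longrightarrow> I' \<subseteq> I \<Longrightarrow> has_FPRAS enc I' f"
  unfolding has_FPRAS_def is_FPRAS_def by (meson subsetD)

theorem theorem1p2:
  assumes "\<not> has_FPRAS enc_bipartite_instance bipartite_instances num_BIS"
  shows "\<not> has_FPRAS enc_st_instance dag_instances unreliability \<and>
         \<not> has_FPRAS enc_st_instance uniform_dag_instances unreliability"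
proof -
  have "uniform_dag_instances \<subseteq> dag_instances" by (auto simp: uniform_dag_instances_def)
  then show ?thesis
    using assms BIS_FPRAS_of_uniform_unreliability_FPRAS has_FPRAS_subset by blast
qed

end
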